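(* Let $P$ be a finite poset, $S=\Bbbk[x_{[2]\times P}]$ and $L=L(2,P)\subseteq S$. Let $p\in P$. Let $U$ be an inclusion-minimal subset of $P\setminus F(\ge p)$ which is an upper bound set for $J(<p)$, and let $D$ be an inclusion-minimal subset of $P\setminus J(\le p)$ which is a lower bound set for $F(>p)$. Suppose also that whenever $r\in D$ and $s\in U$, we do not have $r\le s$. Then the map $$\phi:L\to S/L,\qquad p_1p_2\mapsto\prod_{r\in D}r_1\prod_{s\in U}s_2,$$ sending all other minimal monomial generators of $L$ to zero, is a (well-defined) nonzero map of $S$-modules. Moreover, as $p$ varies over $P$ and $D,U$ vary over the sets with these properties, the maps $\phi$ form a minimal generating set of the cotangent cohomology module $T^1(S/L)$.
   Context: $\Bbbk$ is a field. For $p\in P$ and $i\in\{1,2\}$ there is a variable $x_{i,p}$, written $p_i$; $\Bbbk[x_{[2]\times P}]$ is the polynomial ring in these variables. $L(2,P)$ is the ideal generated by the monomials $p_1q_2$ for all $p\le q$ in $P$ (these are its minimal monomial generators). For $p\in P$: $J(<p)=\{r\in P: r<p\}$, $J(\le p)=\{r\in P:r\le p\}$, $F(>p)=\{q\in P:q>p\}$, $F(\ge p)=\{q\in P:q\ge p\}$. For subsets $J,U\subseteq P$, $U$ is an upper bound set for $J$ if for every $r\in J$ there is $s\in U$ with $r\le s$. For subsets $F,D\subseteq P$, $D$ is a lower bound set for $F$ if for every $q\in F$ there is $r\in D$ with $r\le q$. $T^1(S/L)$ is the cokernel of the map $\delta^*:\mathrm{Der}_\Bbbk(S)\to\mathrm{Hom}_S(L,S/L)$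 sending a derivation $\partial$ to the homomorphism $f\mapsto\partial f+L$; the maps $\phi$ are regarded as elements of $T^1(S/L)$ via their classes. *)

theory Defs
  imports
    "HOL-Algebra.Algebraic_Closure_Type"
    "HOL-Algebra.QuotRing"
    "HOL-Algebra.Module"
    "HOL-Library.Poly_Mapping"
    "HOL-Library.FuncSet"
begin

section \<open>Modules over a commutative ring\<close>

text \<open>
  The record type of modules extends that of rings. The fields \<^const>\<open>monoid.mult\<close> and
  \<^const>\<open>monoid.one\<close> play no role in \<^locale>\<open>module\<close> and \<^locale>\<open>submodule\<close> and are left
  unspecified in the modules below that carry no multiplication.
\<close>

definition regular_module :: "('a, 'm) ring_scheme \<Rightarrow> ('a, 'a) module" where
  "regular_module R =
    \<lparr>carrier = carrier R, monoid.mult = monoid.mult R, one = one R, ring.zero = ring.zero R, ring.add = ring.add R,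
     module.smult = monoid.mult R\<rparr>"

definition quot_module :: "('a, 'b, 'm) module_scheme \<Rightarrow> 'b set \<Rightarrow> ('a, 'b set) module" where
  "quot_module M N =
    \<lparr>carrier = a_rcosets\<^bsub>M\<^esub> N, monoid.mult = undefined, one = undefined, ring.zero = N, ring.add = set_add M,
     module.smult = (\<lambda>r A. \<Union>x\<in>A. N +>\<^bsub>M\<^esub> (r \<odot>\<^bsub>M\<^esub> x))\<rparr>"

text \<open>Homomorphisms are extensional functions, so that equality in the Hom module is equality
  on the domain module.\<close>

definition hom_module ::
  "('a, 'm) ring_scheme \<Rightarrow> ('a, 'b, 'n) module_scheme \<Rightarrow> ('a, 'c, 'o) module_scheme
    \<Rightarrow> ('a, 'b \<Rightarrow> 'c) module" where
  "hom_module R M N =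
    \<lparr>carrier = {h \<in> carrier M \<rightarrow>\<^sub>E carrier N.
       (\<forall>x\<in>carrier M. \<forall>y\<in>carrier M. h (x \<oplus>\<^bsub>M\<^esub> y) = h x \<oplus>\<^bsub>N\<^esub> h y) \<and>
       (\<forall>r\<in>carrier R. \<forall>x\<in>carrier M. h (r \<odot>\<^bsub>M\<^esub> x) = r \<odot>\<^bsub>N\<^esub> h x)},
     monoid.mult = undefined, one = undefined,
     ring.zero = (\<lambda>x\<in>carrier M. \<zero>\<^bsub>N\<^esub>),
     ring.add = (\<lambda>g h. \<lambda>x\<in>carrier M. g x \<oplus>\<^bsub>N\<^esub> h x),
     module.smult = (\<lambda>r h. \<lambda>x\<in>carrier M. r \<odot>\<^bsub>N\<^esub> h x)\<rparr>"

definition generated_submodule ::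
  "('a, 'm) ring_scheme \<Rightarrow> ('a, 'b, 'n) module_scheme \<Rightarrow> 'b set \<Rightarrow> 'b set" where
  "generated_submodule R M G = \<Inter>{N. submodule N R M \<and> G \<subseteq> N}"

definition minimal_generating_set ::
  "('a, 'm) ring_scheme \<Rightarrow> ('a, 'b, 'n) module_scheme \<Rightarrow> 'b set \<Rightarrow> bool" where
  "minimal_generating_set R M G \<longleftrightarrow>
     G \<subseteq> carrier M \<and> generated_submodule R M G = carrier M \<and>
     (\<forall>H. H \<subset> G \<longrightarrow> generated_submodule R M H \<noteq> carrier M)"


section \<open>Polynomial rings and the first cotangent cohomology module\<close>

text \<open>Polynomials in variables from \<^typ>\<open>'v\<close>: finitely supported maps from exponent
  vectors to coefficients, with the convolution product.\<close>

type_synonym ('v, 'k) mpoly = "('v \<Rightarrow>\<^sub>0 nat) \<Rightarrow>\<^sub>0 'k"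

abbreviation const_poly :: "'k \<Rightarrow> ('v, 'k::zero) mpoly" where
  "const_poly c \<equiv> Poly_Mapping.single 0 c"

abbreviation var_poly :: "'v \<Rightarrow> ('v, 'k::zero_neq_one) mpoly" where
  "var_poly v \<equiv> Poly_Mapping.single (Poly_Mapping.single v 1) 1"

abbreviation mpoly_ring :: "('v, 'k::field) mpoly ring" where
  "mpoly_ring \<equiv> ring_of_type_algebra"

definition derivations :: "(('v, 'k::field) mpoly \<Rightarrow> ('v, 'k) mpoly) set" where
  "derivations = {d.
     (\<forall>f g. d (f + g) = d f + d g) \<and>
     (\<forall>c f. d (const_poly c * f) = const_poly c * d f) \<and>
     (\<forall>f g. d (f * g) = f * d g + d f * g)}"

text \<open>$S/I$ as an $S$-module. Its carrier, zero and addition are those of the library quotient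
  ring \<^const>\<open>FactRing\<close>; see \<open>quot_by_FactRing\<close> below.\<close>

definition quot_by :: "('v, 'k::field) mpoly set \<Rightarrow> (('v, 'k) mpoly, ('v, 'k) mpoly set) module"
  where "quot_by I = quot_module (regular_module mpoly_ring) I"

text \<open>$\mathrm{Hom}_S(I, S/I)$\<close>

definition normal_module ::
  "('v, 'k::field) mpoly set \<Rightarrow> (('v, 'k) mpoly, ('v, 'k) mpoly \<Rightarrow> ('v, 'k) mpoly set) module"
  where "normal_module I = hom_module mpoly_ring ((regular_module mpoly_ring)\<lparr>carrier := I\<rparr>) (quot_by I)"

text \<open>$\delta^*$ sends a derivation $\partial$ to the homomorphism $f \mapsto \partial f + I$; its
  cokernel is $T^1(S/I)$.\<close>

definition delta_star ::
  "('v, 'k::field) mpoly set \<Rightarrow> (('v, 'k) mpoly \<Rightarrow> ('v, 'k) mpoly)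
     \<Rightarrow> (('v, 'k) mpoly \<Rightarrow> ('v, 'k) mpoly set)" where
  "delta_star I d = (\<lambda>f\<in>I. I +>\<^bsub>mpoly_ring\<^esub> d f)"

definition T1 ::
  "('v, 'k::field) mpoly set
     \<Rightarrow> (('v, 'k) mpoly, (('v, 'k) mpoly \<Rightarrow> ('v, 'k) mpoly set) set) module" where
  "T1 I = quot_module (normal_module I) (delta_star I ` derivations)"

definition T1_class ::
  "('v, 'k::field) mpoly set \<Rightarrow> (('v, 'k) mpoly \<Rightarrow> ('v, 'k) mpoly set)
     \<Rightarrow> (('v, 'k) mpoly \<Rightarrow> ('v, 'k) mpoly set) set" where
  "T1_class I h = (delta_star I ` derivations) +>\<^bsub>normal_module I\<^esub> h"


section \<open>The ideal $L(2,P)$ and the maps $\phi$\<close>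

text \<open>The index set $[2] \times P$ of the variables.\<close>

datatype 'p var = V1 'p | V2 'p

abbreviation X1 :: "'p \<Rightarrow> ('p var, 'k::field) mpoly" where
  "X1 p \<equiv> var_poly (V1 p)"

abbreviation X2 :: "'p \<Rightarrow> ('p var, 'k::field) mpoly" where
  "X2 p \<equiv> var_poly (V2 p)"

definition L2 :: "('p::order var, 'k::field) mpoly set" where
  "L2 = Idl\<^bsub>mpoly_ring\<^esub> {X1 p * X2 q | p q. p \<le> q}"

definition upper_bound_set :: "'p::order set \<Rightarrow> 'p set \<Rightarrow> bool" where
  "upper_bound_set J U \<longleftrightarrow> (\<forall>r\<in>J. \<exists>s\<in>U. r \<le> s)"

definition lower_bound_set :: "'p::order set \<Rightarrow> 'p set \<Rightarrow> bool" where
  "lower_bound_set F D \<longleftrightarrow> (\<forall>q\<in>F. \<exists>r\<in>D. r \<le> q)"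

definition inclusion_minimal :: "('p set \<Rightarrow> bool) \<Rightarrow> 'p set \<Rightarrow> bool" where
  "inclusion_minimal Q U \<longleftrightarrow> Q U \<and> (\<forall>V. V \<subset> U \<longrightarrow> \<not> Q V)"

text \<open>Here \<open>{p..}\<close>, \<open>{..p}\<close>, \<open>{p<..}\<close> and \<open>{..<p}\<close> are $F(\ge p)$, $J(\le p)$, $F(>p)$ and $J(<p)$.\<close>

definition admissible :: "'p::order \<Rightarrow> 'p set \<Rightarrow> 'p set \<Rightarrow> bool" where
  "admissible p D U \<longleftrightarrow>
     inclusion_minimal (\<lambda>V. V \<subseteq> - {p..} \<and> upper_bound_set {..<p} V) U \<and>
     inclusion_minimal (\<lambda>V. V \<subseteq> - {..p} \<and> lower_bound_set {p<..} V) D \<and>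
     (\<forall>r\<in>D. \<forall>s\<in>U. \<not> r \<le> s)"

text \<open>The defining property of $\phi : L \to S/L$. Homomorphisms are prescribed on the generators
  $a_1 b_2$ with $a \le b$ of \<open>L2\<close>, so that well-definedness amounts to unique existence.\<close>

definition is_phi ::
  "'p::order \<Rightarrow> 'p set \<Rightarrow> 'p set \<Rightarrow> (('p var, 'k::field) mpoly \<Rightarrow> ('p var, 'k) mpoly set) \<Rightarrow> bool"
  where
  "is_phi p D U h \<longleftrightarrow>
     h \<in> carrier (normal_module L2) \<and>
     h (X1 p * X2 p) = L2 +>\<^bsub>mpoly_ring\<^esub> ((\<Prod>r\<in>D. X1 r) * (\<Prod>s\<in>U. X2 s)) \<and>
     (\<forall>a b. a \<le> b \<and> (a, b) \<noteq> (p, p) \<longrightarrow> h (X1 a * X2 b) = \<zero>\<^bsub>quot_by L2\<^esub>)"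

definition phi ::
  "'p::order \<Rightarrow> 'p set \<Rightarrow> 'p set \<Rightarrow> (('p var, 'k::field) mpoly \<Rightarrow> ('p var, 'k) mpoly set)" where
  "phi p D U = (THE h. is_phi p D U h)"

section \<open>The constructions above are modules\<close>

lemma mpoly_ring_simps [simp]:
  "carrier (ring_of_type_algebra :: 'a::ring_1 ring) = UNIV"
  "monoid.mult (ring_of_type_algebra :: 'a::ring_1 ring) = (*)"
  "monoid.one (ring_of_type_algebra :: 'a::ring_1 ring) = 1"
  "ring.zero (ring_of_type_algebra :: 'a::ring_1 ring) = 0"
  "ring.add (ring_of_type_algebra :: 'a::ring_1 ring) = (+)"
  by (auto simp: ring_of_type_algebra_def)

lemma module_regular_module:
  assumes "cring R"
  shows "module R (regular_module R)"
proof -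
  interpret cring R by fact
  show ?thesis
    by (intro moduleI abelian_groupI)
      (auto simp: regular_module_def assms l_distr r_distr a_assoc m_assoc
        intro: a_comm l_neg exI[of _ "\<ominus>\<^bsub>R\<^esub> _"] bexI[of _ "\<ominus>\<^bsub>R\<^esub> _"])
qed

lemma submodule_regular_module:
  assumes "ideal I R" "cring R"
  shows "submodule I R (regular_module R)"
proof -
  interpret ideal I R by fact
  interpret cring R by fact
  interpret M: module R "regular_module R"
    by (intro module_regular_module is_cring)
  have inv: "\<ominus>\<^bsub>regular_module R\<^esub> x = \<ominus>\<^bsub>R\<^esub> x" if "x \<in> carrier R" for x
    using that M.minus_equality[of "\<ominus>\<^bsub>R\<^esub> x" x] by (simp add: regular_module_def l_neg)
  show ?thesis
  proof (rule M.submoduleI)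
    show "\<ominus>\<^bsub>regular_module R\<^esub> x \<in> I" if "x \<in> I" for x
      using that by (simp add: inv)
  qed (simp_all add: regular_module_def a_subset I_l_closed)
qed

lemma abelian_subgroup_submodule:
  assumes "module R M" "submodule N R M"
  shows "abelian_subgroup N M"
proof -
  interpret module R M by fact
  interpret N: submodule N R M by fact
  show ?thesis
    using N.subgroup_axioms
    by (intro abelian_subgroupI3) (auto intro!: additive_subgroup.intro M.abelian_group_axioms)
qed

lemma quot_module_add:
  assumes "module R M" "submodule N R M" "x \<in> carrier M" "y \<in> carrier M"
  shows "(N +>\<^bsub>M\<^esub> x) \<oplus>\<^bsub>quot_module M N\<^esub> (N +>\<^bsub>M\<^esub> y) = N +>\<^bsub>M\<^esub> (x \<oplus>\<^bsub>M\<^esub> y)"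
  using assms abelian_subgroup.a_rcos_sum[OF abelian_subgroup_submodule]
  by (simp add: quot_module_def)

lemma quot_module_smult:
  assumes "module R M" "submodule N R M" "r \<in> carrier R" "x \<in> carrier M"
  shows "r \<odot>\<^bsub>quot_module M N\<^esub> (N +>\<^bsub>M\<^esub> x) = N +>\<^bsub>M\<^esub> (r \<odot>\<^bsub>M\<^esub> x)"
proof -
  interpret module R M by fact
  interpret N: submodule N R M by fact
  interpret G: abelian_subgroup N M
    by (rule abelian_subgroup_submodule) fact+
  have "N +>\<^bsub>M\<^esub> (r \<odot>\<^bsub>M\<^esub> y) = N +>\<^bsub>M\<^esub> (r \<odot>\<^bsub>M\<^esub> x)" if y: "y \<in> N +>\<^bsub>M\<^esub> x" for y
  proof -
    obtain n where n: "n \<in> N" "y = n \<oplus>\<^bsub>M\<^esub> x"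
      using y by (auto simp: a_r_coset_def')
    then have "r \<odot>\<^bsub>M\<^esub> y = r \<odot>\<^bsub>M\<^esub> n \<oplus>\<^bsub>M\<^esub> r \<odot>\<^bsub>M\<^esub> x"
      using assms G.a_subset by (auto simp: smult_r_distr)
    then have "r \<odot>\<^bsub>M\<^esub> y \<in> N +>\<^bsub>M\<^esub> (r \<odot>\<^bsub>M\<^esub> x)"
      using n assms by (auto simp: a_r_coset_def')
    then show ?thesis
      using G.a_repr_independence' assms by (metis smult_closed)
  qed
  moreover have "x \<in> N +>\<^bsub>M\<^esub> x"
    using assms G.a_rcos_self by blast
  ultimately have "(\<Union>y\<in>N +>\<^bsub>M\<^esub> x. N +>\<^bsub>M\<^esub> (r \<odot>\<^bsub>M\<^esub> y)) = N +>\<^bsub>M\<^esub> (r \<odot>\<^bsub>M\<^esub> x)"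
    by blast
  then show ?thesis
    by (simp add: quot_module_def)
qed

lemma module_quot_module:
  assumes "module R M" "submodule N R M"
  shows "module R (quot_module M N)"
proof -
  interpret module R M by fact
  interpret G: abelian_subgroup N M
    by (rule abelian_subgroup_submodule) fact+
  have *: "carrier (quot_module M N) = (\<lambda>x. N +>\<^bsub>M\<^esub> x) ` carrier M"
    by (auto simp: quot_module_def A_RCOSETS_def')
  have zero: "\<zero>\<^bsub>quot_module M N\<^esub> = N +>\<^bsub>M\<^esub> \<zero>\<^bsub>M\<^esub>"
    using G.a_subset by (simp add: quot_module_def)
  show ?thesis
    by (intro moduleI abelian_groupI)
      (auto simp: * quot_module_add[OF assms] quot_module_smult[OF assms] zero smult_l_distr
        smult_r_distr smult_assoc1 M.a_ac M.l_neg M.r_neg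
        intro: R.is_cring, metis M.a_inv_closed M.r_neg)
qed

lemma module_hom_module:
  assumes "module R M" "module R N"
  shows "module R (hom_module R M N)"
proof -
  interpret M: module R M by fact
  interpret N: module R N by fact
  let ?H = "hom_module R M N"
  have H: "h \<in> carrier ?H \<longleftrightarrow> h \<in> carrier M \<rightarrow>\<^sub>E carrier N \<and>
       (\<forall>x\<in>carrier M. \<forall>y\<in>carrier M. h (x \<oplus>\<^bsub>M\<^esub> y) = h x \<oplus>\<^bsub>N\<^esub> h y) \<and>
       (\<forall>r\<in>carrier R. \<forall>x\<in>carrier M. h (r \<odot>\<^bsub>M\<^esub> x) = r \<odot>\<^bsub>N\<^esub> h x)" for h
    by (simp add: hom_module_def)
  have ev: "\<zero>\<^bsub>?H\<^esub> x = \<zero>\<^bsub>N\<^esub>" "(g \<oplus>\<^bsub>?H\<^esub> h) x = g x \<oplus>\<^bsub>N\<^esub> h x" "(r \<odot>\<^bsub>?H\<^esub> h) x = r \<odot>\<^bsub>N\<^esub> h x"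
    if "x \<in> carrier M" for g h r x
    using that by (simp_all add: hom_module_def)
  have ext: "g = h" if "g \<in> carrier ?H" "h \<in> carrier ?H" "\<And>x. x \<in> carrier M \<Longrightarrow> g x = h x" for g h
    using that by (auto simp: H intro: PiE_ext)
  have mem: "h x \<in> carrier N" if "h \<in> carrier ?H" "x \<in> carrier M" for h x
    using that by (auto simp: H)
  have comm: "r \<odot>\<^bsub>N\<^esub> (s \<odot>\<^bsub>N\<^esub> x) = s \<odot>\<^bsub>N\<^esub> (r \<odot>\<^bsub>N\<^esub> x)"
    if "r \<in> carrier R" "s \<in> carrier R" "x \<in> carrier N" for r s x
    using that by (metis N.smult_assoc1 M.R.m_comm)
  have zero: "\<zero>\<^bsub>?H\<^esub> \<in> carrier ?H"
    by (simp add: H ev) (simp add: hom_module_def)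
  have add: "g \<oplus>\<^bsub>?H\<^esub> h \<in> carrier ?H" if gh: "g \<in> carrier ?H" "h \<in> carrier ?H" for g h
  proof -
    have "g \<oplus>\<^bsub>?H\<^esub> h \<in> carrier M \<rightarrow>\<^sub>E carrier N"
      using mem[OF gh(1)] mem[OF gh(2)] by (simp add: hom_module_def)
    moreover have "(g \<oplus>\<^bsub>?H\<^esub> h) (x \<oplus>\<^bsub>M\<^esub> y) = (g \<oplus>\<^bsub>?H\<^esub> h) x \<oplus>\<^bsub>N\<^esub> (g \<oplus>\<^bsub>?H\<^esub> h) y"
      if "x \<in> carrier M" "y \<in> carrier M" for x y
      using gh that mem[OF gh(1)] mem[OF gh(2)] by (simp add: H ev N.a_ac)
    moreover have "(g \<oplus>\<^bsub>?H\<^esub> h) (r \<odot>\<^bsub>M\<^esub> x) = r \<odot>\<^bsub>N\<^esub> (g \<oplus>\<^bsub>?H\<^esub> h) x"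
      if "r \<in> carrier R" "x \<in> carrier M" for r x
      using gh that mem[OF gh(1)] mem[OF gh(2)] by (simp add: H ev N.smult_r_distr)
    ultimately show ?thesis
      unfolding H by blast
  qed
  have smult: "s \<odot>\<^bsub>?H\<^esub> h \<in> carrier ?H" if h: "s \<in> carrier R" "h \<in> carrier ?H" for s h
  proof -
    have "s \<odot>\<^bsub>?H\<^esub> h \<in> carrier M \<rightarrow>\<^sub>E carrier N"
      using h mem[OF h(2)] by (simp add: hom_module_def)
    moreover have "(s \<odot>\<^bsub>?H\<^esub> h) (x \<oplus>\<^bsub>M\<^esub> y) = (s \<odot>\<^bsub>?H\<^esub> h) x \<oplus>\<^bsub>N\<^esub> (s \<odot>\<^bsub>?H\<^esub> h) y"
      if "x \<in> carrier M" "y \<in> carrier M" for x y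
      using h that mem[OF h(2)] by (simp add: H ev N.smult_r_distr)
    moreover have "(s \<odot>\<^bsub>?H\<^esub> h) (r \<odot>\<^bsub>M\<^esub> x) = r \<odot>\<^bsub>N\<^esub> (s \<odot>\<^bsub>?H\<^esub> h) x"
      if "r \<in> carrier R" "x \<in> carrier M" for r x
      using h that mem[OF h(2)] comm[of s r "h x"] by (simp add: H ev)
    ultimately show ?thesis
      unfolding H by blast
  qed
  have neg: "\<exists>g\<in>carrier ?H. g \<oplus>\<^bsub>?H\<^esub> h = \<zero>\<^bsub>?H\<^esub>" if h: "h \<in> carrier ?H" for h
  proof (rule bexI)
    show *: "(\<ominus>\<^bsub>R\<^esub> \<one>\<^bsub>R\<^esub>) \<odot>\<^bsub>?H\<^esub> h \<in> carrier ?H"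
      by (intro smult h) simp
    show "(\<ominus>\<^bsub>R\<^esub> \<one>\<^bsub>R\<^esub>) \<odot>\<^bsub>?H\<^esub> h \<oplus>\<^bsub>?H\<^esub> h = \<zero>\<^bsub>?H\<^esub>"
      using mem[OF h] by (intro ext add zero * h) (simp add: ev N.smult_l_minus N.l_neg)
  qed
  show ?thesis
  proof (intro moduleI abelian_groupI neg M.R.is_cring zero add smult)
    fix g h k assume ghk: "g \<in> carrier ?H" "h \<in> carrier ?H" "k \<in> carrier ?H"
    show "g \<oplus>\<^bsub>?H\<^esub> h \<oplus>\<^bsub>?H\<^esub> k = g \<oplus>\<^bsub>?H\<^esub> (h \<oplus>\<^bsub>?H\<^esub> k)"
      using ghk by (intro ext add) (simp_all add: ev mem N.a_assoc)
  next
    fix g h assume gh: "g \<in> carrier ?H" "h \<in> carrier ?H"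
    show "g \<oplus>\<^bsub>?H\<^esub> h = h \<oplus>\<^bsub>?H\<^esub> g"
      using gh by (intro ext add) (simp_all add: ev mem N.a_comm)
    fix r assume r: "r \<in> carrier R"
    show "r \<odot>\<^bsub>?H\<^esub> (g \<oplus>\<^bsub>?H\<^esub> h) = r \<odot>\<^bsub>?H\<^esub> g \<oplus>\<^bsub>?H\<^esub> r \<odot>\<^bsub>?H\<^esub> h"
      using gh r by (intro ext add smult) (simp_all add: ev mem N.smult_r_distr)
  next
    fix h assume h: "h \<in> carrier ?H"
    show "\<zero>\<^bsub>?H\<^esub> \<oplus>\<^bsub>?H\<^esub> h = h"
      using h by (intro ext add zero) (simp_all add: ev mem)
    show "\<one>\<^bsub>R\<^esub> \<odot>\<^bsub>?H\<^esub> h = h"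
      using h by (intro ext smult) (simp_all add: ev mem)
    fix r s assume rs: "r \<in> carrier R" "s \<in> carrier R"
    show "(r \<oplus>\<^bsub>R\<^esub> s) \<odot>\<^bsub>?H\<^esub> h = r \<odot>\<^bsub>?H\<^esub> h \<oplus>\<^bsub>?H\<^esub> s \<odot>\<^bsub>?H\<^esub> h"
      using h rs by (intro ext add smult) (simp_all add: ev mem N.smult_l_distr)
    show "(r \<otimes>\<^bsub>R\<^esub> s) \<odot>\<^bsub>?H\<^esub> h = r \<odot>\<^bsub>?H\<^esub> (s \<odot>\<^bsub>?H\<^esub> h)"
      using h rs by (intro ext smult) (simp_all add: ev mem N.smult_assoc1)
  qed
qed

lemma cring_mpoly_ring: "cring (mpoly_ring :: ('v, 'k::field) mpoly ring)"
  by (rule cring_from_type_algebra)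

lemma module_quot_by:
  fixes I :: "('v, 'k::field) mpoly set"
  assumes "ideal I mpoly_ring"
  shows "module mpoly_ring (quot_by I)"
  unfolding quot_by_def
  by (rule module_quot_module[OF module_regular_module[OF cring_mpoly_ring]
        submodule_regular_module[OF assms cring_mpoly_ring]])

lemma quot_by_FactRing:
  fixes I :: "('v, 'k::field) mpoly set"
  shows "carrier (quot_by I) = carrier (mpoly_ring Quot I)"
    and "\<zero>\<^bsub>quot_by I\<^esub> = \<zero>\<^bsub>mpoly_ring Quot I\<^esub>"
    and "ring.add (quot_by I) = ring.add (mpoly_ring Quot I)"
    and "f \<odot>\<^bsub>quot_by I\<^esub> A = (\<Union>g\<in>A. I +>\<^bsub>mpoly_ring\<^esub> (f * g))"
  by (simp_all add: quot_by_def quot_module_def regular_module_def FactRing_def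
      A_RCOSETS_def RCOSETS_def r_coset_def set_add_def set_mult_def a_r_coset_def' fun_eq_iff)

lemma module_normal_module:
  fixes I :: "('v, 'k::field) mpoly set"
  assumes "ideal I mpoly_ring"
  shows "module mpoly_ring (normal_module I)"
  unfolding normal_module_def
  by (rule module_hom_module[OF
        submodule.submodule_is_module[OF submodule_regular_module[OF assms cring_mpoly_ring]
          module_regular_module[OF cring_mpoly_ring]]
        module_quot_by[OF assms]])

lemma submodule_delta_star:
  fixes I :: "('v, 'k::field) mpoly set"
  assumes "ideal I mpoly_ring"
  shows "submodule (delta_star I ` derivations) mpoly_ring (normal_module I)"
proof -
  let ?S = "regular_module mpoly_ring :: (('v, 'k) mpoly, ('v, 'k) mpoly) module"
  let ?H = "normal_module I"
  note S = module_regular_module[OF cring_mpoly_ring]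
  note I = submodule_regular_module[OF assms cring_mpoly_ring]
  interpret ideal I mpoly_ring by fact
  interpret H: module mpoly_ring ?H
    by (rule module_normal_module[OF assms])
  interpret G: abelian_subgroup I ?S
    by (rule abelian_subgroup_submodule[OF S I])
  have S_simps [simp]: "carrier ?S = UNIV" "ring.add ?S = (+)" "module.smult ?S = (*)" "ring.zero ?S = 0"
    by (simp_all add: regular_module_def)
  have H_simps: "\<zero>\<^bsub>?H\<^esub> = (\<lambda>x\<in>I. \<zero>\<^bsub>quot_by I\<^esub>)"
    "g \<oplus>\<^bsub>?H\<^esub> h = (\<lambda>x\<in>I. g x \<oplus>\<^bsub>quot_by I\<^esub> h x)"
    "r \<odot>\<^bsub>?H\<^esub> h = (\<lambda>x\<in>I. r \<odot>\<^bsub>quot_by I\<^esub> h x)" for g h r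
    by (simp_all add: normal_module_def hom_module_def)
  have delta: "delta_star I d = (\<lambda>f\<in>I. I +>\<^bsub>?S\<^esub> d f)" for d
    by (simp add: delta_star_def a_r_coset_def')
  have q_add: "(I +>\<^bsub>?S\<^esub> f) \<oplus>\<^bsub>quot_by I\<^esub> (I +>\<^bsub>?S\<^esub> g) = I +>\<^bsub>?S\<^esub> (f + g)" for f g
    using quot_module_add[OF S I, of f g] by (simp add: quot_by_def)
  have q_smult: "f \<odot>\<^bsub>quot_by I\<^esub> (I +>\<^bsub>?S\<^esub> g) = I +>\<^bsub>?S\<^esub> (f * g)" for f g
    using quot_module_smult[OF S I, of f g] by (simp add: quot_by_def)
  have coset_in: "I +>\<^bsub>?S\<^esub> f \<in> carrier (quot_by I)" for f
    by (auto simp: quot_by_def quot_module_def A_RCOSETS_def')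
  have absorb: "I +>\<^bsub>?S\<^esub> (f + i) = I +>\<^bsub>?S\<^esub> f" if "i \<in> I" for f i
  proof (rule G.a_repr_independence'[symmetric])
    show "f + i \<in> I +>\<^bsub>?S\<^esub> f"
      using that by (auto simp: a_r_coset_def' add.commute)
  qed simp
  have Imult: "f * g \<in> I" if "g \<in> I" for f g
    using I_l_closed[OF that, of f] by simp
  have I0: "0 \<in> I"
    using additive_subgroup.zero_closed[OF additive_subgroup_axioms] by simp
  have Iadd: "f + g \<in> I" if "f \<in> I" "g \<in> I" for f g
    using additive_subgroup.a_closed[OF additive_subgroup_axioms that] by simp
  show ?thesis
  proof (rule H.submoduleI)
    show sub: "delta_star I ` derivations \<subseteq> carrier ?H"
      by (auto simp: normal_module_def hom_module_def delta derivations_def coset_in q_add q_smult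
          absorb Imult Iadd)
    show "\<zero>\<^bsub>?H\<^esub> \<in> delta_star I ` derivations"
      by (rule image_eqI[of _ _ "\<lambda>_. 0"])
        (auto simp: H_simps delta derivations_def quot_by_def quot_module_def
          G.a_rcos_const[OF I0] intro!: restrict_ext)
    show add: "g \<oplus>\<^bsub>?H\<^esub> h \<in> delta_star I ` derivations"
      if gh: "g \<in> delta_star I ` derivations" "h \<in> delta_star I ` derivations" for g h
    proof -
      obtain d e where "d \<in> derivations" "e \<in> derivations" "g = delta_star I d" "h = delta_star I e"
        using gh by blast
      then show ?thesis
        by (intro image_eqI[of _ _ "\<lambda>f. d f + e f"])
          (auto simp: H_simps delta derivations_def q_add algebra_simps intro!: restrict_ext)
    qed
    show smult: "r \<odot>\<^bsub>?H\<^esub> h \<in> delta_star I ` derivations"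
      if h: "h \<in> delta_star I ` derivations" for r h
    proof -
      obtain d where "d \<in> derivations" "h = delta_star I d"
        using h by blast
      then show ?thesis
        by (intro image_eqI[of _ _ "\<lambda>f. r * d f"])
          (auto simp: H_simps delta derivations_def q_smult algebra_simps intro!: restrict_ext)
    qed
    show "\<ominus>\<^bsub>?H\<^esub> h \<in> delta_star I ` derivations" if h: "h \<in> delta_star I ` derivations" for h
    proof -
      have "\<ominus>\<^bsub>?H\<^esub> h = (\<ominus>\<^bsub>mpoly_ring\<^esub> \<one>\<^bsub>mpoly_ring\<^esub>) \<odot>\<^bsub>?H\<^esub> h"
        using h sub H.smult_l_minus[of "\<one>\<^bsub>mpoly_ring\<^esub>" h] H.smult_one[of h] by auto
      then show ?thesis
        using smult h by simp
    qed
  qed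
qed

lemma module_T1:
  fixes I :: "('v, 'k::field) mpoly set"
  assumes "ideal I mpoly_ring"
  shows "module mpoly_ring (T1 I)"
  unfolding T1_def
  by (rule module_quot_module[OF module_normal_module[OF assms] submodule_delta_star[OF assms]])

lemma ideal_L2: "ideal L2 (mpoly_ring :: ('p::order var, 'k::field) mpoly ring)"
proof -
  interpret cring "mpoly_ring :: ('p var, 'k) mpoly ring"
    by (rule cring_mpoly_ring)
  show ?thesis
    unfolding L2_def by (intro genideal_ideal) auto
qed

end

theory Submission
  imports Defs
begin

text \<open>
  The ideal \<open>L\<close> is generated by quadratic squarefree monomials, so \<open>Hom(L, S/L)\<close> can be understood one
  monomial at a time: a homomorphism is a choice of coefficients, one for each generator \<open>a\<^sub>1b\<^sub>2\<close> and
  each standard monomial (a monomial outside \<open>L\<close>), subject to the conditions that the syzygies between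
  the generators impose. A standard monomial \<open>m\<close> in the value at \<open>a\<^sub>1b\<^sub>2\<close> contains at most one of \<open>a\<^sub>1\<close>
  and \<open>b\<^sub>2\<close>.

  If \<open>m\<close> contains one of them, the syzygies force the coefficients to be those of a derivation
  (\<open>subtract_derivation\<close>), so this part dies in \<open>T\<^sup>1\<close>. If \<open>m\<close> contains neither, the syzygies say that
  the product of \<open>m\<close> with every \<open>b'\<^sub>2\<close>, \<open>a \<le> b' \<noteq> b\<close>, and with every \<open>a'\<^sub>1\<close>, \<open>b \<ge> a' \<noteq> a\<close>, lies in \<open>L\<close>.
  The combinatorial lemma \<open>isolated_monomial_divisible\<close> shows that this forces \<open>a = b\<close> and that \<open>m\<close>
  is a multiple of the value of \<open>\<phi>\<close> for some admissible \<open>(a, D, U)\<close>. Hence the classes of the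
  maps \<open>\<phi>\<close> generate \<open>T\<^sup>1\<close> (\<open>phi_generate\<close>). Conversely, the bound set conditions are just what makes \<open>\<phi>\<close>
  compatible with the syzygies (\<open>hom_lift_phi_lift\<close>), and \<open>\<phi>\<close> is nonzero because no element of \<open>D\<close> lies
  below one of \<open>U\<close>, so that its value at \<open>p\<^sub>1p\<^sub>2\<close> is a standard monomial.

  The generating set is irredundant because the values of the maps \<open>\<phi>\<close> for a given \<open>p\<close> are monomials
  of which none divides another. Concretely, the homomorphisms whose value at \<open>p\<^sub>1p\<^sub>2\<close> involves no divisor of
  \<open>t = \<Prod>r\<in>D. r\<^sub>1 * \<Prod>s\<in>U. s\<^sub>2\<close> form a submodule that contains \<open>\<delta>\<^sup>*\<close> of all derivations and all the
  other maps, but not the map of \<open>(p, D, U)\<close>. The same submodules separate the classes, so distinct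
  triples have distinct classes.
\<close>

section \<open>Polynomials as combinations of monomials\<close>

lemma mpoly_eq_sum_monomials:
  "f = (\<Sum>n\<in>Poly_Mapping.keys f. Poly_Mapping.single n (Poly_Mapping.lookup f n))"
proof (rule poly_mapping_eqI)
  fix k
  have "(\<Sum>n\<in>Poly_Mapping.keys f. Poly_Mapping.lookup (Poly_Mapping.single n (Poly_Mapping.lookup f n)) k) =
      (\<Sum>n\<in>Poly_Mapping.keys f. if n = k then Poly_Mapping.lookup f n else 0)"
    by (intro sum.cong) (simp_all add: lookup_single when_def)
  then show "Poly_Mapping.lookup f k = Poly_Mapping.lookup
      (\<Sum>n\<in>Poly_Mapping.keys f. Poly_Mapping.single n (Poly_Mapping.lookup f n)) k"
    by (simp add: lookup_sum sum.delta in_keys_iff)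
qed

text \<open>
  Additive statements need only be checked on monomials. The set \<open>N\<close> keeps track of which monomials
  occur, which is what membership in a monomial ideal is about.
\<close>

lemma mpoly_induct_monomials [consumes 1, case_names zero monomial add]:
  fixes f :: "'a \<Rightarrow>\<^sub>0 'b::comm_monoid_add"
  assumes "Poly_Mapping.keys f \<subseteq> N"
    and "P 0"
    and "\<And>n c. n \<in> N \<Longrightarrow> P (Poly_Mapping.single n c)"
    and "\<And>f g. \<lbrakk>Poly_Mapping.keys f \<subseteq> N; Poly_Mapping.keys g \<subseteq> N; P f; P g\<rbrakk> \<Longrightarrow> P (f + g)"
  shows "P f"
proof -
  let ?g = "\<lambda>A. \<Sum>n\<in>A. Poly_Mapping.single n (Poly_Mapping.lookup f n)"
  have "Poly_Mapping.keys (?g A) \<subseteq> N \<and> P (?g A)" if "finite A" "A \<subseteq> Poly_Mapping.keys f" for A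
    using that
  proof induction
    case (insert n A)
    have n: "n \<in> N"
      using insert.prems assms(1) by blast
    have eq: "?g (insert n A) = Poly_Mapping.single n (Poly_Mapping.lookup f n) + ?g A"
      using insert.hyps by simp
    have IH: "Poly_Mapping.keys (?g A) \<subseteq> N" "P (?g A)"
      using insert by auto
    have single: "Poly_Mapping.keys (Poly_Mapping.single n (Poly_Mapping.lookup f n)) \<subseteq> N"
      using n by simp
    have "P (?g (insert n A))"
      unfolding eq using IH single n by (intro assms(3,4))
    moreover have "Poly_Mapping.keys (?g (insert n A)) \<subseteq> N"
      unfolding eq using IH(1) single by (intro order_trans[OF keys_add] Un_least)
    ultimately show ?case
      by blast
  qed (use assms(2) in auto)
  from this[OF finite_keys subset_refl] show ?thesis
    unfolding mpoly_eq_sum_monomials[of f, symmetric] by (rule conjunct2)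
qed

lemma mpoly_induct [case_names zero monomial add]:
  fixes f :: "'a \<Rightarrow>\<^sub>0 'b::comm_monoid_add"
  assumes "P 0" "\<And>n c. P (Poly_Mapping.single n c)" "\<And>f g. \<lbrakk>P f; P g\<rbrakk> \<Longrightarrow> P (f + g)"
  shows "P f"
  by (rule mpoly_induct_monomials[where N = UNIV]) (auto intro: assms)

lemma monomial_split:
  assumes "Poly_Mapping.lookup n v > 0"
  obtains m where "n = m + Poly_Mapping.single v (1::nat)"
proof
  show "n = (n - Poly_Mapping.single v 1) + Poly_Mapping.single v 1"
    using assms by (intro poly_mapping_eqI) (auto simp: lookup_add lookup_minus lookup_single when_def)
qed

lemma lookup_monomial_times:
  fixes f :: "('v, 'k::field) mpoly"
  shows "Poly_Mapping.lookup (Poly_Mapping.single e c * f) (e + m) = c * Poly_Mapping.lookup f m"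
proof (induction f rule: mpoly_induct)
  case (monomial n d)
  show ?case
    by (simp add: mult_single lookup_single when_def)
qed (simp_all add: distrib_left lookup_add)

lemma lookup_times_eq_0:
  fixes f g :: "('v, 'k::field) mpoly"
  assumes "\<And>a b. m = a + b \<Longrightarrow> Poly_Mapping.lookup f a = 0 \<or> Poly_Mapping.lookup g b = 0"
  shows "Poly_Mapping.lookup (f * g) m = 0"
  using keys_mult[of f g] assms by (fastforce simp: in_keys_iff)

lemma lookup_var_times_eq_0:
  fixes f :: "('v, 'k::field) mpoly"
  assumes "Poly_Mapping.lookup m v = 0"
  shows "Poly_Mapping.lookup (var_poly v * f) m = 0"
  using assms by (intro lookup_times_eq_0) (auto simp: lookup_add lookup_single when_def)

definition linear_extension ::
  "('a \<Rightarrow> 'b::zero \<Rightarrow> 'c::comm_monoid_add) \<Rightarrow> ('a \<Rightarrow>\<^sub>0 'b) \<Rightarrow> 'c" where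
  "linear_extension g f = (\<Sum>n\<in>Poly_Mapping.keys f. g n (Poly_Mapping.lookup f n))"

lemma linear_extension_single:
  "(\<And>n. g n 0 = 0) \<Longrightarrow> linear_extension g (Poly_Mapping.single n c) = g n c"
  by (simp add: linear_extension_def)

lemma linear_extension_add:
  assumes "\<And>n. g n 0 = 0" "\<And>n c d. g n (c + d) = g n c + g n d"
  shows "linear_extension g (f + f') = linear_extension g f + linear_extension g f'"
  unfolding linear_extension_def using assms by (rule setsum_keys_plus_distrib)


section \<open>Derivations with prescribed values on the variables\<close>

text \<open>
  The truncated subtraction of exponents is harmless: where it truncates, the coefficient is zero.
\<close>

definition partial_deriv :: "'v \<Rightarrow> ('v, 'k::field) mpoly \<Rightarrow> ('v, 'k) mpoly" where
  "partial_deriv v = linear_extension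
     (\<lambda>n c. Poly_Mapping.single (n - Poly_Mapping.single v 1) (of_nat (Poly_Mapping.lookup n v) * c))"

lemma partial_deriv_single:
  "partial_deriv v (Poly_Mapping.single n c) =
     Poly_Mapping.single (n - Poly_Mapping.single v 1) (of_nat (Poly_Mapping.lookup n v) * c)"
  by (simp add: partial_deriv_def linear_extension_single)

lemma partial_deriv_add: "partial_deriv v (f + g) = partial_deriv v f + partial_deriv v g"
  unfolding partial_deriv_def
  by (rule linear_extension_add) (simp_all add: single_add distrib_left)

lemma partial_deriv_0: "partial_deriv v 0 = 0"
  by (simp add: partial_deriv_def linear_extension_def)

lemma partial_deriv_mult_monomials:
  fixes c d :: "'k::field"
  shows "partial_deriv v (Poly_Mapping.single n c * Poly_Mapping.single m d) =
    Poly_Mapping.single n c * partial_deriv v (Poly_Mapping.single m d) +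
    partial_deriv v (Poly_Mapping.single n c) * Poly_Mapping.single m d"
proof -
  let ?v = "Poly_Mapping.single v (1::nat)"
  have left: "n + (m - ?v) = n + m - ?v" if m: "Poly_Mapping.lookup m v > 0" for n m
  proof -
    obtain k where "m = k + ?v"
      using m by (rule monomial_split)
    then show ?thesis
      by (simp add: add.assoc[symmetric])
  qed
  have right: "(n - ?v) + m = n + m - ?v" if "Poly_Mapping.lookup n v > 0" for n m
    using left[OF that, of m] by (simp add: add.commute)
  consider "Poly_Mapping.lookup n v = 0" "Poly_Mapping.lookup m v = 0"
    | "Poly_Mapping.lookup n v = 0" "Poly_Mapping.lookup m v > 0"
    | "Poly_Mapping.lookup n v > 0" "Poly_Mapping.lookup m v = 0"
    | "Poly_Mapping.lookup n v > 0" "Poly_Mapping.lookup m v > 0"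
    by linarith
  then show ?thesis
  proof cases
    case 1
    then show ?thesis
      by (simp add: mult_single partial_deriv_single lookup_add)
  next
    case 2
    then show ?thesis
      by (simp add: mult_single partial_deriv_single lookup_add left mult.left_commute del: One_nat_def)
  next
    case 3
    then show ?thesis
      by (simp add: mult_single partial_deriv_single lookup_add right mult.assoc del: One_nat_def)
  next
    case 4
    then show ?thesis
      by (simp add: mult_single partial_deriv_single lookup_add left right single_add[symmetric]
          distrib_right distrib_left mult_ac[where ?'a = 'k] add.commute[where ?'a = 'k] del: One_nat_def)
  qed
qed

lemma partial_deriv_mult:
  "partial_deriv v (f * g) = f * partial_deriv v g + partial_deriv v f * g"
proof (induction f rule: mpoly_induct)
  case (monomial n c)
  show ?case
  proof (induction g rule: mpoly_induct)
    case (monomial m d)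
    show ?case
      by (rule partial_deriv_mult_monomials)
  qed (simp_all only: partial_deriv_0 partial_deriv_add distrib_left distrib_right add_ac mult_zero_left mult_zero_right add_0)
qed (simp_all only: partial_deriv_0 partial_deriv_add distrib_left distrib_right add_ac mult_zero_left mult_zero_right add_0)

text \<open>
  \<open>Der(S)\<close> is free on the partial derivatives, so \<open>\<Sum>v. A v * \<partial>/\<partial>v\<close> does it.
\<close>

lemma derivation_exists:
  fixes A :: "'v \<Rightarrow> ('v, 'k::field) mpoly"
  assumes "finite (UNIV :: 'v set)"
  obtains d where "d \<in> derivations" "\<And>v. d (var_poly v) = A v"
proof
  let ?d = "\<lambda>f. \<Sum>v\<in>UNIV. A v * partial_deriv v f"
  have const: "partial_deriv v (const_poly c) = 0" for v and c :: 'k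
    by (simp add: partial_deriv_single)
  show "?d \<in> derivations"
    unfolding derivations_def mem_Collect_eq
  proof (intro conjI allI)
    show "?d (f + g) = ?d f + ?d g" for f g
      by (simp add: partial_deriv_add distrib_left sum.distrib)
    show "?d (const_poly c * f) = const_poly c * ?d f" for c f
      by (simp add: partial_deriv_mult const sum_distrib_left mult.left_commute)
    show "?d (f * g) = f * ?d g + ?d f * g" for f g
      by (simp add: partial_deriv_mult distrib_left sum.distrib sum_distrib_left sum_distrib_right
          mult.left_commute mult.assoc)
  qed
  have "partial_deriv v (var_poly w) = (if v = w then 1 else 0 :: ('v, 'k) mpoly)" for v w
    by (auto simp: partial_deriv_single lookup_single when_def)
  then have "?d (var_poly w) = (\<Sum>v\<in>UNIV. if v = w then A v else 0)" for w
    by (intro sum.cong) simp_all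
  then show "?d (var_poly w) = A w" for w
    using assms by simp
qed


(* Expressions such as single v 1 are kept in this form, rather than rewritten to Suc 0. *)
declare One_nat_def [simp del]


section \<open>Standard monomials\<close>

text \<open>
  The standard monomials are those outside the monomial ideal \<open>L2\<close>. Their residue classes form a
  basis of \<open>S/L\<close>, so that an element of \<open>S/L\<close> is known as soon as the coefficients of a
  representative at the standard monomials are.
\<close>

definition standard :: "('p::order var \<Rightarrow>\<^sub>0 nat) \<Rightarrow> bool" where
  "standard m \<longleftrightarrow>
     (\<forall>r s. r \<le> s \<longrightarrow> Poly_Mapping.lookup m (V1 r) = 0 \<or> Poly_Mapping.lookup m (V2 s) = 0)"

lemma standard_factor: "standard (a + b) \<Longrightarrow> standard b"
  unfolding standard_def lookup_add by (metis add_is_0)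

abbreviation gen_expo :: "'p \<Rightarrow> 'p \<Rightarrow> 'p var \<Rightarrow>\<^sub>0 nat" where
  "gen_expo a b \<equiv> Poly_Mapping.single (V1 a) 1 + Poly_Mapping.single (V2 b) 1"

abbreviation gen :: "'p \<Rightarrow> 'p \<Rightarrow> ('p var, 'k::field) mpoly" where
  "gen a b \<equiv> X1 a * X2 b"

lemma gen_eq_monomial:
  "gen a b = Poly_Mapping.single (gen_expo a b) 1"
  by (simp add: mult_single)

lemma not_standardE:
  assumes "\<not> standard n"
  obtains a b k where "a \<le> b" "n = k + gen_expo a b"
proof -
  obtain a b where ab: "a \<le> b" "Poly_Mapping.lookup n (V1 a) > 0" "Poly_Mapping.lookup n (V2 b) > 0"
    using assms by (auto simp: standard_def)
  obtain m where m: "n = m + Poly_Mapping.single (V1 a) 1"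
    using ab(2) by (rule monomial_split)
  then have "Poly_Mapping.lookup m (V2 b) > 0"
    using ab(3) by (simp add: lookup_add lookup_single)
  then obtain k where "m = k + Poly_Mapping.single (V2 b) 1"
    by (rule monomial_split)
  then show thesis
    using that[of a b k] ab m by (simp add: add_ac)
qed

lemma ideal_nonstandard:
  "ideal {f :: ('p::order var, 'k::field) mpoly. \<forall>m. standard m \<longrightarrow> Poly_Mapping.lookup f m = 0} mpoly_ring"
    (is "ideal ?J _")
proof -
  interpret cring "mpoly_ring :: ('p var, 'k) mpoly ring"
    by (rule cring_mpoly_ring)
  have mult: "s * f \<in> ?J" if "f \<in> ?J" for s f
    using that by (auto intro!: lookup_times_eq_0 dest: standard_factor)
  show ?thesis
  proof (rule idealI)
    show "ring (mpoly_ring :: ('p var, 'k) mpoly ring)"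
      by (rule ring_axioms)
    show "subgroup ?J (add_monoid (mpoly_ring :: ('p var, 'k) mpoly ring))"
    proof (rule add.subgroupI)
      show "\<ominus>\<^bsub>mpoly_ring\<^esub> f \<in> ?J" if "f \<in> ?J" for f
      proof -
        have "\<ominus>\<^bsub>mpoly_ring\<^esub> f = - f"
          using minus_equality[of "- f" f] by simp
        then show ?thesis
          using that by simp
      qed
    qed (auto simp: lookup_add intro!: exI[of _ 0])
  qed (use mult in \<open>auto simp: mult.commute\<close>)
qed

lemma gen_in_L2: "a \<le> b \<Longrightarrow> (gen a b :: ('p::order var, 'k::field) mpoly) \<in> L2"
proof -
  interpret cring "mpoly_ring :: ('p var, 'k) mpoly ring"
    by (rule cring_mpoly_ring)
  show "a \<le> b \<Longrightarrow> (gen a b :: ('p var, 'k) mpoly) \<in> L2"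
    unfolding L2_def using genideal_self[of "{gen a b | a b. a \<le> b}"] by auto
qed

lemma L2_0: "(0 :: ('p::order var, 'k::field) mpoly) \<in> L2"
  using additive_subgroup.zero_closed[OF ideal.axioms(1)[OF ideal_L2]] by simp

lemma L2_add: "f \<in> L2 \<Longrightarrow> g \<in> L2 \<Longrightarrow> f + g \<in> (L2 :: ('p::order var, 'k::field) mpoly set)"
  using additive_subgroup.a_closed[OF ideal.axioms(1)[OF ideal_L2]] by simp

lemma L2_mult: "f \<in> L2 \<Longrightarrow> s * f \<in> (L2 :: ('p::order var, 'k::field) mpoly set)"
  using ideal.I_l_closed[OF ideal_L2, of f s] by simp

lemma L2_diff: "f \<in> L2 \<Longrightarrow> g \<in> L2 \<Longrightarrow> f - g \<in> (L2 :: ('p::order var, 'k::field) mpoly set)"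
  using L2_add[of f "(- 1) * g"] L2_mult[of g "- 1"] by simp

text \<open>
  An ideal generated by monomials is spanned by the monomials that it contains.
\<close>

lemma L2_iff_standard:
  fixes f :: "('p::order var, 'k::field) mpoly"
  shows "f \<in> L2 \<longleftrightarrow> (\<forall>m. standard m \<longrightarrow> Poly_Mapping.lookup f m = 0)"
proof
  interpret cring "mpoly_ring :: ('p var, 'k) mpoly ring"
    by (rule cring_mpoly_ring)
  have "{gen a b | a b. a \<le> b} \<subseteq>
      {f :: ('p var, 'k) mpoly. \<forall>m. standard m \<longrightarrow> Poly_Mapping.lookup f m = 0}"
    by (auto simp: gen_eq_monomial lookup_single when_def standard_def lookup_add simp del: One_nat_def)
      (metis add_is_0 lookup_single_eq zero_neq_one)+
  then show "f \<in> L2 \<Longrightarrow> \<forall>m. standard m \<longrightarrow> Poly_Mapping.lookup f m = 0"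
    using genideal_minimal[OF ideal_nonstandard] unfolding L2_def by blast
next
  assume *: "\<forall>m. standard m \<longrightarrow> Poly_Mapping.lookup f m = 0"
  have "Poly_Mapping.keys f \<subseteq> {n. \<not> standard n}"
    using * by (auto simp: in_keys_iff)
  then show "f \<in> L2"
  proof (induction f rule: mpoly_induct_monomials)
    case (monomial n c)
    then have "\<not> standard n"
      by simp
    then obtain a b k where "a \<le> b"
      "n = k + gen_expo a b"
      by (rule not_standardE)
    then have "Poly_Mapping.single n c = Poly_Mapping.single k c * gen a b"
      by (simp add: gen_eq_monomial mult_single)
    then show ?case
      using L2_mult[OF gen_in_L2[OF \<open>a \<le> b\<close>]] by simp
  qed (simp_all add: L2_0 L2_add)
qed

lemma L2_induct [consumes 1, case_names zero monomial add]:
  fixes f :: "('p::order var, 'k::field) mpoly"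
  assumes "f \<in> L2" and zero: "P 0"
    and monomial: "\<And>k c a b. a \<le> b \<Longrightarrow> P (Poly_Mapping.single k c * gen a b)"
    and add: "\<And>f g. \<lbrakk>f \<in> L2; g \<in> L2; P f; P g\<rbrakk> \<Longrightarrow> P (f + g)"
  shows "P f"
proof -
  have in_L2: "f \<in> L2 \<longleftrightarrow> Poly_Mapping.keys f \<subseteq> {n. \<not> standard n}" for f :: "('p var, 'k) mpoly"
    by (auto simp: L2_iff_standard in_keys_iff)
  have "Poly_Mapping.keys f \<subseteq> {n. \<not> standard n}"
    using assms(1) by (simp add: in_L2)
  then show ?thesis
  proof (induction f rule: mpoly_induct_monomials)
    case (monomial n c)
    then have "\<not> standard n"
      by simp
    then obtain a b k where "a \<le> b"
      "n = k + gen_expo a b"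
      by (rule not_standardE)
    then have "Poly_Mapping.single n c = Poly_Mapping.single k c * gen a b"
      by (simp add: gen_eq_monomial mult_single)
    then show ?case
      using assms(3)[OF \<open>a \<le> b\<close>] by simp
  next
    case (add f g)
    then show ?case
      by (intro assms(4)) (simp_all add: in_L2)
  qed (rule zero)
qed


section \<open>Lifting homomorphisms to polynomials\<close>

abbreviation coset_L2 :: "('p::order var, 'k::field) mpoly \<Rightarrow> ('p var, 'k) mpoly set" where
  "coset_L2 f \<equiv> L2 +>\<^bsub>mpoly_ring\<^esub> f"

lemma coset_L2_eq_iff: "coset_L2 f = coset_L2 g \<longleftrightarrow> f - g \<in> L2"
proof
  assume "coset_L2 f = coset_L2 g"
  moreover have "f \<in> coset_L2 f"
    using L2_0 by (force simp: a_r_coset_def')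
  ultimately show "f - g \<in> L2"
    by (auto simp: a_r_coset_def')
next
  assume *: "f - g \<in> L2"
  have "x - g \<in> L2 \<longleftrightarrow> x - f \<in> L2" for x
    using L2_add[OF _ *, of "x - f"] L2_diff[OF _ *, of "x - g"] by auto
  moreover have "coset_L2 h = {x. x - h \<in> L2}" for h
    by (force simp: a_r_coset_def')
  ultimately show "coset_L2 f = coset_L2 g"
    by auto
qed

lemma quot_L2:
  shows carrier_quot_L2: "carrier (quot_by L2) = range coset_L2"
    and zero_quot_L2: "\<zero>\<^bsub>quot_by L2\<^esub> = coset_L2 0"
    and add_quot_L2: "coset_L2 f \<oplus>\<^bsub>quot_by L2\<^esub> coset_L2 g = coset_L2 (f + g)"
    and smult_quot_L2: "s \<odot>\<^bsub>quot_by L2\<^esub> coset_L2 f = coset_L2 (s * f)"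
proof -
  note S = module_regular_module[OF cring_mpoly_ring]
  note I = submodule_regular_module[OF ideal_L2 cring_mpoly_ring]
  have S_simps [simp]: "carrier (regular_module mpoly_ring) = UNIV"
    "ring.add (regular_module mpoly_ring) = (+)" "module.smult (regular_module mpoly_ring) = (*)"
    by (simp_all add: regular_module_def)
  have coset: "coset_L2 f = L2 +>\<^bsub>regular_module mpoly_ring\<^esub> f" for f
    by (simp add: a_r_coset_def')
  show "carrier (quot_by L2) = range coset_L2"
    by (auto simp: quot_by_def quot_module_def A_RCOSETS_def' a_r_coset_def')
  show "\<zero>\<^bsub>quot_by L2\<^esub> = coset_L2 0"
    by (simp add: quot_by_def quot_module_def a_r_coset_def')
  show "coset_L2 f \<oplus>\<^bsub>quot_by L2\<^esub> coset_L2 g = coset_L2 (f + g)"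
    using quot_module_add[OF S I, of f g] by (simp add: quot_by_def coset)
  show "s \<odot>\<^bsub>quot_by L2\<^esub> coset_L2 f = coset_L2 (s * f)"
    using quot_module_smult[OF S I, of s f] by (simp add: quot_by_def coset)
qed

text \<open>
  A homomorphism \<open>L \<rightarrow> S/L\<close> is handled through a choice of representatives \<open>H f\<close> of its values. This
  replaces equations between cosets by membership in \<open>L2\<close>, hence by equations between coefficients
  at standard monomials. The condition \<open>hom_lift\<close> says that \<open>H\<close> is linear modulo \<open>L2\<close>; a derivation
  is such an \<open>H\<close>, and the homomorphism that it induces is its image under \<open>\<delta>\<^sup>*\<close>.
\<close>

definition hom_of ::
  "(('p::order var, 'k::field) mpoly \<Rightarrow> ('p var, 'k) mpoly) \<Rightarrow> ('p var, 'k) mpoly \<Rightarrow> ('p var, 'k) mpoly set"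
  where "hom_of H = (\<lambda>f\<in>L2. coset_L2 (H f))"

definition hom_lift :: "(('p::order var, 'k::field) mpoly \<Rightarrow> ('p var, 'k) mpoly) \<Rightarrow> bool" where
  "hom_lift H \<longleftrightarrow>
     (\<forall>f\<in>L2. \<forall>g\<in>L2. H (f + g) - (H f + H g) \<in> L2) \<and> (\<forall>s. \<forall>f\<in>L2. H (s * f) - s * H f \<in> L2)"

lemma hom_liftD:
  assumes "hom_lift H" "f \<in> L2"
  shows "g \<in> L2 \<Longrightarrow> H (f + g) - (H f + H g) \<in> L2" and "H (s * f) - s * H f \<in> L2"
  using assms by (auto simp: hom_lift_def)

lemma mem_normal_module_iff:
  "h \<in> carrier (normal_module L2) \<longleftrightarrow> h \<in> L2 \<rightarrow>\<^sub>E range coset_L2 \<and>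
     (\<forall>f\<in>L2. \<forall>g\<in>L2. h (f + g) = h f \<oplus>\<^bsub>quot_by L2\<^esub> h g) \<and>
     (\<forall>s. \<forall>f\<in>L2. h (s * f) = s \<odot>\<^bsub>quot_by L2\<^esub> h f)"
  by (simp add: normal_module_def hom_module_def regular_module_def carrier_quot_L2)

lemma hom_of_in_normal_module_iff: "hom_of H \<in> carrier (normal_module L2) \<longleftrightarrow> hom_lift H"
  by (auto simp: mem_normal_module_iff hom_of_def hom_lift_def add_quot_L2 smult_quot_L2 coset_L2_eq_iff
      L2_add L2_mult)

lemma carrier_normal_module: "carrier (normal_module L2) = hom_of ` {H. hom_lift H}"
proof
  show "hom_of ` {H. hom_lift H} \<subseteq> carrier (normal_module L2)"
    using hom_of_in_normal_module_iff by blast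
  show "carrier (normal_module L2) \<subseteq> hom_of ` {H. hom_lift H}"
  proof
    fix h assume h: "h \<in> carrier (normal_module L2)"
    then have maps: "h \<in> L2 \<rightarrow>\<^sub>E range coset_L2"
      unfolding mem_normal_module_iff by blast
    then have "\<forall>f\<in>L2. \<exists>g. h f = coset_L2 g"
      by blast
    then obtain H where "\<And>f. f \<in> L2 \<Longrightarrow> h f = coset_L2 (H f)"
      by metis
    then have "h f = hom_of H f" for f
      using PiE_arb[OF maps, of f] by (simp add: hom_of_def)
    then have "h = hom_of H"
      by blast
    then show "h \<in> hom_of ` {H. hom_lift H}"
      using h hom_of_in_normal_module_iff by blast
  qed
qed

lemma hom_of_zero: "\<zero>\<^bsub>normal_module L2\<^esub> = hom_of (\<lambda>_. 0)"
  by (simp add: normal_module_def hom_module_def hom_of_def zero_quot_L2 fun_eq_iff)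

lemma hom_of_add: "hom_of H \<oplus>\<^bsub>normal_module L2\<^esub> hom_of K = hom_of (\<lambda>f. H f + K f)"
  by (auto simp: normal_module_def hom_module_def hom_of_def add_quot_L2 fun_eq_iff)

lemma hom_of_smult: "s \<odot>\<^bsub>normal_module L2\<^esub> hom_of H = hom_of (\<lambda>f. s * H f)"
  by (auto simp: normal_module_def hom_module_def hom_of_def smult_quot_L2 fun_eq_iff)

lemma hom_of_eq_iff: "hom_of H = hom_of K \<longleftrightarrow> (\<forall>f\<in>L2. H f - K f \<in> L2)"
  by (auto simp: hom_of_def fun_eq_iff coset_L2_eq_iff)

lemma hom_lift_zero: "hom_lift (\<lambda>_. 0)"
  by (simp add: hom_lift_def L2_0)

lemma hom_lift_add:
  assumes "hom_lift H" "hom_lift K"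
  shows "hom_lift (\<lambda>f. H f + K f)"
  unfolding hom_lift_def
proof (intro conjI ballI allI)
  fix f g :: "('a var, 'b) mpoly" and s :: "('a var, 'b) mpoly"
  assume f: "f \<in> L2"
  show "H (s * f) + K (s * f) - s * (H f + K f) \<in> L2"
    using L2_add[OF hom_liftD(2)[OF assms(1) f, of s] hom_liftD(2)[OF assms(2) f, of s]]
    by (simp add: algebra_simps)
  assume g: "g \<in> L2"
  show "H (f + g) + K (f + g) - (H f + K f + (H g + K g)) \<in> L2"
    using L2_add[OF hom_liftD(1)[OF assms(1) f g] hom_liftD(1)[OF assms(2) f g]]
    by (simp add: algebra_simps)
qed

lemma hom_lift_smult:
  assumes "hom_lift H"
  shows "hom_lift (\<lambda>f. r * H f)"
  unfolding hom_lift_def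
proof (intro conjI ballI allI)
  fix f g :: "('a var, 'b) mpoly" and s :: "('a var, 'b) mpoly"
  assume f: "f \<in> L2"
  show "r * H (s * f) - s * (r * H f) \<in> L2"
    using L2_mult[OF hom_liftD(2)[OF assms f, of s], of r]
    by (simp add: algebra_simps)
  assume g: "g \<in> L2"
  show "r * H (f + g) - (r * H f + r * H g) \<in> L2"
    using L2_mult[OF hom_liftD(1)[OF assms f g], of r]
    by (simp add: algebra_simps)
qed

text \<open>
  By the Leibniz rule \<open>d (s * f)\<close> and \<open>s * d f\<close> differ by \<open>d s * f\<close>, which lies in the ideal with \<open>f\<close>.
\<close>

lemma derivation_hom_lift:
  assumes "d \<in> derivations"
  shows "hom_lift d"
proof -
  have add: "d (f + g) = d f + d g" and mult: "d (f * g) = f * d g + d f * g" for f g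
    using assms by (auto simp: derivations_def)
  show ?thesis
    by (simp add: hom_lift_def add mult L2_0 L2_mult)
qed

lemma delta_star_eq_hom_of: "delta_star L2 d = hom_of d"
  by (simp add: delta_star_def hom_of_def)

text \<open>
  The difference of the two lifts is again a lift, and the \<open>f \<in> L\<close> that it sends into \<open>L\<close>
  form an ideal containing the generators.
\<close>

lemma hom_of_eqI:
  assumes H: "hom_lift H" and K: "hom_lift K"
    and gens: "\<And>a b. a \<le> b \<Longrightarrow> H (gen a b) - K (gen a b) \<in> L2"
  shows "hom_of H = hom_of K"
proof -
  have lift: "hom_lift (\<lambda>f. H f - K f)"
    using hom_lift_add[OF H hom_lift_smult[OF K, of "- 1"]] by simp
  note D = hom_liftD[OF lift]
  have "H f - K f \<in> L2" if "f \<in> L2" for f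
    using that
  proof (induction f rule: L2_induct)
    case zero
    show ?case
      using D(2)[OF L2_0, of 0] by simp
  next
    case (monomial k c a b)
    let ?s = "Poly_Mapping.single k c"
    show ?case
      using L2_add[OF D(2)[OF gen_in_L2[OF monomial], of ?s] L2_mult[OF gens[OF monomial], of ?s]]
      by (simp only: diff_add_cancel)
  next
    case (add f g)
    show ?case
      using L2_add[OF D(1)[OF add.hyps] L2_add[OF add.IH]] by (simp only: diff_add_cancel)
  qed
  then show ?thesis
    by (simp add: hom_of_eq_iff)
qed


section \<open>The homomorphisms attached to admissible triples\<close>

definition target_expo :: "'p set \<Rightarrow> 'p set \<Rightarrow> 'p var \<Rightarrow>\<^sub>0 nat" where
  "target_expo D U = (\<Sum>r\<in>D. Poly_Mapping.single (V1 r) 1) + (\<Sum>s\<in>U. Poly_Mapping.single (V2 s) 1)"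

lemma lookup_target_expo:
  fixes D U :: "'p::finite set"
  shows "Poly_Mapping.lookup (target_expo D U) (V1 r) = of_bool (r \<in> D)"
    and "Poly_Mapping.lookup (target_expo D U) (V2 s) = of_bool (s \<in> U)"
  by (simp_all add: target_expo_def lookup_add lookup_sum lookup_single when_def)

lemma prod_monomials:
  "(\<Prod>x\<in>A. Poly_Mapping.single (e x) 1) = (Poly_Mapping.single (\<Sum>x\<in>A. e x) 1 :: ('v, 'k::field) mpoly)"
  by (induction A rule: infinite_finite_induct) (simp_all add: mult_single)

lemma monomial_target_expo:
  "(\<Prod>r\<in>D. X1 r) * (\<Prod>s\<in>U. X2 s) = (Poly_Mapping.single (target_expo D U) 1 :: ('p var, 'k::field) mpoly)"
  by (simp add: prod_monomials mult_single target_expo_def)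

lemma target_expo_factor:
  fixes D U :: "'p::finite set"
  assumes "\<And>r. r \<in> D \<Longrightarrow> Poly_Mapping.lookup m (V1 r) > 0"
    and "\<And>s. s \<in> U \<Longrightarrow> Poly_Mapping.lookup m (V2 s) > 0"
  obtains k where "m = k + target_expo D U"
proof
  show "m = (m - target_expo D U) + target_expo D U"
  proof (rule poly_mapping_eqI)
    show "Poly_Mapping.lookup m v = Poly_Mapping.lookup ((m - target_expo D U) + target_expo D U) v" for v
    proof (cases v)
      case (V1 r)
      then show ?thesis
        using assms(1)[of r] by (cases "r \<in> D") (simp_all add: lookup_add lookup_minus lookup_target_expo)
    next
      case (V2 s)
      then show ?thesis
        using assms(2)[of s] by (cases "s \<in> U") (simp_all add: lookup_add lookup_minus lookup_target_expo)
    qed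
  qed
qed

lemma admissible_minimal:
  assumes "admissible p D U"
  shows "inclusion_minimal (\<lambda>V. V \<subseteq> - {p..} \<and> upper_bound_set {..<p} V) U"
    and "inclusion_minimal (\<lambda>V. V \<subseteq> - {..p} \<and> lower_bound_set {p<..} V) D"
  using assms by (simp_all add: admissible_def)

lemma admissibleD:
  assumes "admissible p D U"
  shows "upper_bound_set {..<p} U" "lower_bound_set {p<..} D" "U \<subseteq> - {p..}" "D \<subseteq> - {..p}"
    and "\<And>r s. r \<in> D \<Longrightarrow> s \<in> U \<Longrightarrow> \<not> r \<le> s"
  using assms by (auto simp: admissible_def inclusion_minimal_def)

lemma standard_target_expo:
  fixes D U :: "'p::{finite,order} set"
  shows "standard (target_expo D U) \<longleftrightarrow> (\<forall>r\<in>D. \<forall>s\<in>U. \<not> r \<le> s)"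
  by (auto simp: standard_def lookup_target_expo)

abbreviation gen_divides :: "'p \<Rightarrow> ('p var \<Rightarrow>\<^sub>0 nat) \<Rightarrow> bool" where
  "gen_divides p n \<equiv> Poly_Mapping.lookup n (V1 p) > 0 \<and> Poly_Mapping.lookup n (V2 p) > 0"

lemma gen_dividesE:
  assumes "gen_divides p n"
  obtains k where "n = k + gen_expo p p"
proof
  show "n = (n - gen_expo p p) + gen_expo p p"
    using assms
    by (intro poly_mapping_eqI) (auto simp: lookup_add lookup_minus lookup_single when_def)
qed

text \<open>
  Divide by \<open>p\<^sub>1p\<^sub>2\<close>, dropping the monomials that are not divisible by it, and multiply by the
  prescribed value on \<open>p\<^sub>1p\<^sub>2\<close>. This is additive on all of \<open>S\<close>, so that the only question left about
  well-definedness is linearity over \<open>S\<close>.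
\<close>

definition phi_lift :: "'p \<Rightarrow> 'p set \<Rightarrow> 'p set \<Rightarrow> ('p var, 'k::field) mpoly \<Rightarrow> ('p var, 'k) mpoly" where
  "phi_lift p D U = linear_extension
     (\<lambda>n c. if gen_divides p n then Poly_Mapping.single (n - gen_expo p p + target_expo D U) c else 0)"

lemma phi_lift_add: "phi_lift p D U (f + g) = phi_lift p D U f + phi_lift p D U g"
  unfolding phi_lift_def by (rule linear_extension_add) (simp_all add: single_add)

lemma phi_lift_0: "phi_lift p D U 0 = 0"
  by (simp add: phi_lift_def linear_extension_def)

lemma phi_lift_single_multiple:
  "phi_lift p D U (Poly_Mapping.single (k + gen_expo p p) c) = Poly_Mapping.single (k + target_expo D U) c"
  by (simp add: phi_lift_def linear_extension_single lookup_add)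

lemma phi_lift_single_other:
  "\<not> gen_divides p n \<Longrightarrow> phi_lift p D U (Poly_Mapping.single n c) = 0"
  by (subst phi_lift_def, subst linear_extension_single) auto

lemma phi_lift_gen: "phi_lift p D U (gen p p) = Poly_Mapping.single (target_expo D U) 1"
  using phi_lift_single_multiple[of p D U 0 1] by (simp add: gen_eq_monomial)

lemma phi_lift_other_gen:
  assumes "(a, b) \<noteq> (p, p)"
  shows "phi_lift p D U (gen a b) = 0"
proof -
  have "\<not> gen_divides p (gen_expo a b)"
    using assms by (auto simp: lookup_add lookup_single when_def)
  then show ?thesis
    unfolding gen_eq_monomial by (rule phi_lift_single_other)
qed

text \<open>
  Linearity can only fail where multiplication by a monomial \<open>e\<close> turns a multiple \<open>n\<close> of a generator
  \<open>a\<^sub>1b\<^sub>2\<close> that is not a multiple of \<open>p\<^sub>1p\<^sub>2\<close> into one that is. The value at \<open>e + n\<close> must then lie in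
  \<open>L2\<close>. If \<open>a = p\<close>, then \<open>b > p\<close>, and \<open>b\<^sub>2\<close> survives the division by \<open>p\<^sub>1p\<^sub>2\<close>; since \<open>D\<close> is a lower
  bound set, it pairs with some \<open>r\<^sub>1\<close>, \<open>r \<in> D\<close>, to an element of \<open>L2\<close>. The case \<open>b = p\<close> is dual and
  uses \<open>U\<close>. In all other cases \<open>a\<^sub>1b\<^sub>2\<close> itself survives.
\<close>

lemma hom_lift_phi_lift:
  fixes D U :: "'p::{finite,order} set"
  assumes "upper_bound_set {..<p} U" "lower_bound_set {p<..} D"
  shows "hom_lift (phi_lift p D U :: ('p var, 'k::field) mpoly \<Rightarrow> _)"
proof -
  let ?P = "phi_lift p D U :: ('p var, 'k) mpoly \<Rightarrow> _"
  have monomials: "?P (Poly_Mapping.single (e + (k + gen_expo a b)) (d * c)) -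
      Poly_Mapping.single e d * ?P (Poly_Mapping.single (k + gen_expo a b) c) \<in> L2"
    if ab: "a \<le> b" for e k d c a b
  proof -
    let ?n = "k + gen_expo a b"
    consider "gen_divides p ?n" | "\<not> gen_divides p (e + ?n)"
      | "\<not> gen_divides p ?n" "gen_divides p (e + ?n)"
      by blast
    then show ?thesis
    proof cases
      case 1
      then obtain l where "?n = l + gen_expo p p"
        by (rule gen_dividesE)
      then show ?thesis
        using phi_lift_single_multiple[of p D U "e + l" "d * c"]
        by (simp add: phi_lift_single_multiple mult_single L2_0 add.assoc)
    next
      case 2
      then have "\<not> gen_divides p ?n"
        by (simp add: lookup_add) blast
      with 2 show ?thesis
        by (simp add: phi_lift_single_other L2_0)
    next
      case 3
      obtain l where l: "e + ?n = l + gen_expo p p"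
        using 3(2) by (rule gen_dividesE)
      have V1: "Poly_Mapping.lookup l (V1 a) > 0" if "a \<noteq> p"
        using arg_cong[OF l, of "\<lambda>m. Poly_Mapping.lookup m (V1 a)"] that
        by (simp add: lookup_add lookup_single)
      have V2: "Poly_Mapping.lookup l (V2 b) > 0" if "b \<noteq> p"
        using arg_cong[OF l, of "\<lambda>m. Poly_Mapping.lookup m (V2 b)"] that
        by (simp add: lookup_add lookup_single)
      have "\<not> standard (l + target_expo D U)"
      proof -
        consider "a = p" "p < b" | "b = p" "a < p" | "a \<noteq> p" "b \<noteq> p"
          using 3(1) ab by (cases "a = p"; cases "b = p") (auto simp: lookup_add lookup_single)
        then show ?thesis
        proof cases
          case 1
          then obtain r where "r \<in> D" "r \<le> b"
            using assms(2) by (auto simp: lower_bound_set_def)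
          then show ?thesis
            using V2 1 by (auto simp: standard_def lookup_add lookup_target_expo)
        next
          case 2
          then obtain s where "s \<in> U" "a \<le> s"
            using assms(1) by (auto simp: upper_bound_set_def)
          then show ?thesis
            using V1 2 by (auto simp: standard_def lookup_add lookup_target_expo)
        next
          case 3
          then show ?thesis
            using V1 V2 ab by (auto simp: standard_def lookup_add)
        qed
      qed
      then have "Poly_Mapping.single (l + target_expo D U) (d * c) \<in> L2"
        by (auto simp: L2_iff_standard lookup_single when_def)
      then show ?thesis
        using 3(1) by (simp add: l phi_lift_single_multiple phi_lift_single_other)
    qed
  qed
  have mult: "?P (s * f) - s * ?P f \<in> L2" if "f \<in> L2" for s f
    using that
  proof (induction f rule: L2_induct)
    case zero
    then show ?case
      by (simp add: phi_lift_0 L2_0)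
  next
    case (monomial k c a b)
    have f: "Poly_Mapping.single k c * gen a b = Poly_Mapping.single (k + gen_expo a b) c"
      by (simp add: gen_eq_monomial mult_single)
    show ?case
      unfolding f
    proof (induction s rule: mpoly_induct)
      case (monomial e d)
      show ?case
        unfolding mult_single by (rule monomials) fact
    next
      case (add s t)
      then show ?case
        using L2_add[OF add] by (simp add: phi_lift_add algebra_simps)
    qed (simp add: phi_lift_0 L2_0)
  next
    case (add f g)
    then show ?case
      using L2_add[OF add.IH] by (simp add: phi_lift_add algebra_simps)
  qed
  show ?thesis
    unfolding hom_lift_def using mult by (simp add: phi_lift_add L2_0)
qed

lemma is_phi_hom_of_iff:
  assumes "hom_lift H"
  shows "is_phi p D U (hom_of H) \<longleftrightarrow>
    H (gen p p) - Poly_Mapping.single (target_expo D U) 1 \<in> L2 \<and>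
    (\<forall>a b. a \<le> b \<and> (a, b) \<noteq> (p, p) \<longrightarrow> H (gen a b) \<in> L2)"
proof -
  have val: "hom_of H (gen a b) = coset_L2 (H (gen a b))" if "a \<le> b" for a b
    by (simp add: hom_of_def gen_in_L2 that)
  show ?thesis
    using assms
    by (simp add: is_phi_def hom_of_in_normal_module_iff monomial_target_expo zero_quot_L2 val
        coset_L2_eq_iff)
qed

lemma is_phi_phi_lift:
  fixes p :: "'p::{finite,order}"
  assumes "admissible p D U"
  shows "is_phi p D U (hom_of (phi_lift p D U))"
  by (subst is_phi_hom_of_iff)
    (simp_all add: hom_lift_phi_lift admissibleD[OF assms] phi_lift_gen phi_lift_other_gen L2_0
      del: split_paired_All)

lemma is_phi_unique:
  assumes "is_phi p D U g" "is_phi p D U h"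
  shows "g = h"
proof -
  obtain G H where GH: "hom_lift G" "g = hom_of G" "hom_lift H" "h = hom_of H"
  proof -
    have "g \<in> carrier (normal_module L2)" "h \<in> carrier (normal_module L2)"
      using assms by (simp_all only: is_phi_def)
    then show thesis
      using that by (auto simp only: carrier_normal_module)
  qed
  note G = assms(1)[unfolded GH(2) is_phi_hom_of_iff[OF GH(1)]]
  note H = assms(2)[unfolded GH(4) is_phi_hom_of_iff[OF GH(3)]]
  have "G (gen a b) - H (gen a b) \<in> L2" if "a \<le> b" for a b
  proof (cases "(a, b) = (p, p)")
    case True
    have "G (gen p p) - H (gen p p) \<in> L2"
      using L2_diff[OF conjunct1[OF G] conjunct1[OF H]] by (simp only: diff_diff_eq2 diff_add_cancel)
    with True show ?thesis
      by (simp only: prod.inject)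
  next
    case False
    with that show ?thesis
      using L2_diff[of "G (gen a b)" "H (gen a b)"] conjunct2[OF G] conjunct2[OF H] by blast
  qed
  then show ?thesis
    unfolding GH(2,4) by (rule hom_of_eqI[OF GH(1,3)])
qed

lemma phi_eq:
  fixes p :: "'p::{finite,order}"
  assumes "admissible p D U"
  shows "phi p D U = hom_of (phi_lift p D U)"
  unfolding phi_def by (rule the_equality) (rule is_phi_phi_lift[OF assms], erule is_phi_unique, rule is_phi_phi_lift[OF assms])

lemma phi_nonzero:
  fixes p :: "'p::{finite,order}"
  assumes "admissible p D U"
  shows "(phi p D U :: ('p var, 'k::field) mpoly \<Rightarrow> _) \<noteq> \<zero>\<^bsub>normal_module L2\<^esub>"
proof
  assume "(phi p D U :: ('p var, 'k) mpoly \<Rightarrow> _) = \<zero>\<^bsub>normal_module L2\<^esub>"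
  then have "\<forall>f\<in>L2. phi_lift p D U (f :: ('p var, 'k) mpoly) - 0 \<in> L2"
    by (simp only: phi_eq[OF assms] hom_of_zero hom_of_eq_iff)
  then have "phi_lift p D U (gen p p :: ('p var, 'k) mpoly) - 0 \<in> L2"
    by (rule bspec) (rule gen_in_L2[OF order_refl])
  moreover have "standard (target_expo D U)"
    using admissibleD(5)[OF assms] by (simp add: standard_target_expo)
  ultimately show False
    unfolding phi_lift_gen L2_iff_standard by (metis diff_zero lookup_single_eq zero_neq_one)
qed


section \<open>Standard monomials isolated by the syzygies\<close>

lemma inclusion_minimal_subset_exists:
  assumes "finite A" "Q A"
  obtains B where "B \<subseteq> A" "inclusion_minimal Q B"
proof -
  have "\<exists>B\<subseteq>A. inclusion_minimal Q B"
    using assms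
  proof (induction A rule: finite_psubset_induct)
    case (psubset A)
    show ?case
    proof (cases "inclusion_minimal Q A")
      case False
      then obtain C where C: "C \<subset> A" "Q C"
        using psubset.prems unfolding inclusion_minimal_def by blast
      obtain B where "B \<subseteq> C" "inclusion_minimal Q B"
        using psubset.IH[OF C] by (elim exE conjE)
      then show ?thesis
        using C(1) by (intro exI[of _ B]) simp
    qed blast
  qed
  then show thesis
    using that by blast
qed

lemma not_standard_times_V1:
  assumes "standard m" "\<not> standard (m + Poly_Mapping.single (V1 a) 1)"
  obtains s where "a \<le> s" "Poly_Mapping.lookup m (V2 s) > 0"
  using assms by (auto simp: standard_def lookup_add lookup_single when_def split: if_splits)

lemma not_standard_times_V2:
  assumes "standard m" "\<not> standard (m + Poly_Mapping.single (V2 b) 1)"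
  obtains r where "r \<le> b" "Poly_Mapping.lookup m (V1 r) > 0"
  using assms by (auto simp: standard_def lookup_add lookup_single when_def split: if_splits)

text \<open>
  This is the combinatorial heart. The hypotheses are what the syzygies impose on a standard monomial
  \<open>m\<close> that occurs in the value of a homomorphism at \<open>a\<^sub>1b\<^sub>2\<close> and contains neither \<open>a\<^sub>1\<close> nor \<open>b\<^sub>2\<close>. Let \<open>?D\<close>
  and \<open>?U\<close> be the sets of \<open>r\<close> with \<open>r\<^sub>1\<close> dividing \<open>m\<close> and of \<open>s\<close> with \<open>s\<^sub>2\<close> dividing \<open>m\<close>; no element of
  \<open>?D\<close> is below one of \<open>?U\<close>. Since multiplying \<open>m\<close> by \<open>b'\<^sub>2\<close> makes it nonstandard, some element of
  \<open>?D\<close> is below \<open>b'\<close>, and dually for \<open>?U\<close>. If \<open>a < b\<close>, the choices \<open>b' = a\<close> and \<open>a' = b\<close> give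
  \<open>r \<le> a < b \<le> s\<close>, a contradiction. For \<open>a = b\<close> it follows that \<open>?D\<close> and \<open>?U\<close> are bound sets of the
  required kind, and any minimal ones inside them give a divisor of \<open>m\<close>.
\<close>

lemma isolated_monomial_divisible:
  fixes a b :: "'p::{finite,order}"
  assumes m: "standard m" and ab: "a \<le> b"
    and zero: "Poly_Mapping.lookup m (V1 a) = 0" "Poly_Mapping.lookup m (V2 b) = 0"
    and V2: "\<And>b'. a \<le> b' \<Longrightarrow> b' \<noteq> b \<Longrightarrow> \<not> standard (m + Poly_Mapping.single (V2 b') 1)"
    and V1: "\<And>a'. a' \<le> b \<Longrightarrow> a' \<noteq> a \<Longrightarrow> \<not> standard (m + Poly_Mapping.single (V1 a') 1)"
  shows "a = b \<and> (\<exists>D U k. admissible a D U \<and> m = k + target_expo D U)"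
proof -
  let ?D = "{r. Poly_Mapping.lookup m (V1 r) > 0}" and ?U = "{s. Poly_Mapping.lookup m (V2 s) > 0}"
  have no_le: "\<not> r \<le> s" if "r \<in> ?D" "s \<in> ?U" for r s
    using m that by (force simp: standard_def)
  have below: "\<exists>r\<in>?D. r \<le> b'" if "a \<le> b'" "b' \<noteq> b" for b'
    using not_standard_times_V2[OF m V2[OF that]] by blast
  have above: "\<exists>s\<in>?U. a' \<le> s" if "a' \<le> b" "a' \<noteq> a" for a'
    using not_standard_times_V1[OF m V1[OF that]] by blast
  have eq: "a = b"
  proof (rule ccontr)
    assume "a \<noteq> b"
    then obtain r s where "r \<in> ?D" "r \<le> a" "s \<in> ?U" "b \<le> s"
      using below[of a] above[of b] ab by blast
    then show False
      using no_le ab order_trans by metis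
  qed
  have "lower_bound_set {a<..} ?D" "upper_bound_set {..<a} ?U"
    using below above eq by (auto simp: lower_bound_set_def upper_bound_set_def)
  moreover have "?D \<subseteq> - {..a}"
  proof
    fix r assume r: "r \<in> ?D"
    have "\<not> r \<le> a"
    proof
      assume "r \<le> a"
      moreover have "r \<noteq> a"
        using r zero by auto
      ultimately show False
        using above[of r] eq no_le[OF r] by blast
    qed
    then show "r \<in> - {..a}"
      by simp
  qed
  moreover have "?U \<subseteq> - {a..}"
  proof
    fix s assume s: "s \<in> ?U"
    have "\<not> a \<le> s"
    proof
      assume "a \<le> s"
      moreover have "s \<noteq> a"
        using s zero eq by auto
      ultimately show False
        using below[of s] eq no_le[OF _ s] by blast
    qed
    then show "s \<in> - {a..}"
      by simp
  qed
  ultimately have "?U \<subseteq> - {a..} \<and> upper_bound_set {..<a} ?U" "?D \<subseteq> - {..a} \<and> lower_bound_set {a<..} ?D"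
    by blast+
  then obtain D U where DU: "D \<subseteq> ?D" "inclusion_minimal (\<lambda>V. V \<subseteq> - {..a} \<and> lower_bound_set {a<..} V) D"
    "U \<subseteq> ?U" "inclusion_minimal (\<lambda>V. V \<subseteq> - {a..} \<and> upper_bound_set {..<a} V) U"
    using inclusion_minimal_subset_exists[of ?U "\<lambda>V. V \<subseteq> - {a..} \<and> upper_bound_set {..<a} V"]
      inclusion_minimal_subset_exists[of ?D "\<lambda>V. V \<subseteq> - {..a} \<and> lower_bound_set {a<..} V"]
    by (metis (no_types, lifting) finite)
  then have "admissible a D U"
    using no_le unfolding admissible_def by blast
  moreover obtain k where "m = k + target_expo D U"
    using DU(1,3) by (auto intro: target_expo_factor[of D m U])
  ultimately show ?thesis
    using eq by blast
qed


section \<open>Classes in the cotangent cohomology module\<close>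

abbreviation T1_of ::
  "(('p::order var, 'k::field) mpoly \<Rightarrow> ('p var, 'k) mpoly) \<Rightarrow> (('p var, 'k) mpoly \<Rightarrow> ('p var, 'k) mpoly set) set"
  where "T1_of H \<equiv> T1_class L2 (hom_of H)"

lemma carrier_T1: "carrier (T1 L2) = T1_of ` {H. hom_lift H}"
  by (auto simp: T1_def T1_class_def quot_module_def A_RCOSETS_def' carrier_normal_module)

lemma T1_operations:
  fixes H K :: "('p::order var, 'k::field) mpoly \<Rightarrow> ('p var, 'k) mpoly"
  assumes "hom_lift H" "hom_lift K"
  shows T1_of_add: "T1_of H \<oplus>\<^bsub>T1 L2\<^esub> T1_of K = T1_of (\<lambda>f. H f + K f)"
    and T1_of_smult: "s \<odot>\<^bsub>T1 L2\<^esub> T1_of H = T1_of (\<lambda>f. s * H f)"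
  using assms
    quot_module_add[OF module_normal_module[OF ideal_L2] submodule_delta_star[OF ideal_L2], of "hom_of H" "hom_of K"]
    quot_module_smult[OF module_normal_module[OF ideal_L2] submodule_delta_star[OF ideal_L2], of s "hom_of H"]
  by (simp_all add: T1_def T1_class_def hom_of_in_normal_module_iff hom_of_add hom_of_smult)

lemma T1_of_derivation:
  fixes d :: "('p::order var, 'k::field) mpoly \<Rightarrow> ('p var, 'k) mpoly"
  assumes "d \<in> derivations"
  shows "T1_of d = \<zero>\<^bsub>T1 L2\<^esub>"
proof -
  interpret G: abelian_subgroup "delta_star L2 ` derivations" "normal_module (L2 :: ('p var, 'k) mpoly set)"
    by (rule abelian_subgroup_submodule[OF module_normal_module[OF ideal_L2] submodule_delta_star[OF ideal_L2]])
  have "hom_of d \<in> delta_star L2 ` derivations"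
    using assms by (simp flip: delta_star_eq_hom_of)
  from G.a_rcos_const[OF this] show ?thesis
    by (simp add: T1_class_def T1_def quot_module_def)
qed

text \<open>
  Equality in the cokernel, unfolded: the two homomorphisms differ by one coming from a derivation.
\<close>

lemma T1_of_eqD:
  fixes H K :: "('p::order var, 'k::field) mpoly \<Rightarrow> ('p var, 'k) mpoly"
  assumes "T1_of H = T1_of K" "hom_lift H"
  obtains d where "d \<in> derivations" "\<And>f. f \<in> L2 \<Longrightarrow> H f - (d f + K f) \<in> L2"
proof -
  interpret G: abelian_subgroup "delta_star L2 ` derivations" "normal_module (L2 :: ('p var, 'k) mpoly set)"
    by (rule abelian_subgroup_submodule[OF module_normal_module[OF ideal_L2] submodule_delta_star[OF ideal_L2]])
  have "hom_of H \<in> T1_of H"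
    unfolding T1_class_def using assms(2) by (intro G.a_rcos_self) (simp add: hom_of_in_normal_module_iff)
  then obtain d where "d \<in> derivations" "hom_of H = hom_of d \<oplus>\<^bsub>normal_module L2\<^esub> hom_of K"
    unfolding assms(1) by (auto simp: T1_class_def a_r_coset_def' delta_star_eq_hom_of)
  then show thesis
    using that by (simp add: hom_of_add hom_of_eq_iff)
qed

lemma (in module) submodule_from_smult:
  assumes "H \<subseteq> carrier M" "\<zero>\<^bsub>M\<^esub> \<in> H" "\<And>a b. a \<in> H \<Longrightarrow> b \<in> H \<Longrightarrow> a \<oplus>\<^bsub>M\<^esub> b \<in> H"
    and smult: "\<And>a x. a \<in> carrier R \<Longrightarrow> x \<in> H \<Longrightarrow> a \<odot>\<^bsub>M\<^esub> x \<in> H"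
  shows "submodule H R M"
proof (rule submoduleI)
  fix x assume x: "x \<in> H"
  have "\<ominus>\<^bsub>M\<^esub> x = (\<ominus> \<one>) \<odot>\<^bsub>M\<^esub> x"
    using x assms(1) by (subst smult_l_minus) auto
  then show "\<ominus>\<^bsub>M\<^esub> x \<in> H"
    using smult[OF _ x] by simp
qed (use assms in auto)

lemma submodule_closed:
  fixes N :: "(('p::order var, 'k::field) mpoly \<Rightarrow> ('p var, 'k) mpoly set) set set"
  assumes N: "submodule N mpoly_ring (T1 L2)"
  shows "d \<in> derivations \<Longrightarrow> T1_of d \<in> N"
    and "\<lbrakk>hom_lift H; hom_lift K; T1_of H \<in> N; T1_of K \<in> N\<rbrakk> \<Longrightarrow> T1_of (\<lambda>f. H f + K f) \<in> N"
    and "\<lbrakk>hom_lift H; T1_of H \<in> N\<rbrakk> \<Longrightarrow> T1_of (\<lambda>f. s * H f) \<in> N"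
proof -
  interpret T: module mpoly_ring "T1 (L2 :: ('p var, 'k) mpoly set)"
    by (rule module_T1[OF ideal_L2])
  note E = T.submoduleE[OF N]
  show "d \<in> derivations \<Longrightarrow> T1_of d \<in> N"
    using subgroup.one_closed[OF submodule.axioms(1)[OF N]] by (simp add: T1_of_derivation)
  show "\<lbrakk>hom_lift H; hom_lift K; T1_of H \<in> N; T1_of K \<in> N\<rbrakk> \<Longrightarrow> T1_of (\<lambda>f. H f + K f) \<in> N"
    using E(5)[of "T1_of H" "T1_of K"] by (simp add: T1_of_add)
  show "\<lbrakk>hom_lift H; T1_of H \<in> N\<rbrakk> \<Longrightarrow> T1_of (\<lambda>f. s * H f) \<in> N"
    using E(4)[of s "T1_of H"] by (simp add: T1_of_smult)
qed

lemma zero_derivation: "(\<lambda>_. 0) \<in> derivations"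
  by (simp add: derivations_def)


section \<open>Generation\<close>

lemma hom_lift_relation:
  assumes "hom_lift H" "f \<in> L2" "g \<in> L2" "s * f = t * g"
  shows "s * H f - t * H g \<in> L2"
  using L2_diff[OF hom_liftD(2)[OF assms(1,3), of t] hom_liftD(2)[OF assms(1,2), of s]] assms(4)
  by simp

lemma finite_UNIV_var: "finite (UNIV :: 'p::finite var set)"
proof -
  have eq: "(UNIV :: 'p var set) = range V1 \<union> range V2"
    by (auto simp: image_iff) (metis var.exhaust)
  have "finite (range V1 \<union> range V2 :: 'p var set)"
    by simp
  then show ?thesis
    unfolding eq .
qed

text \<open>
  The part of \<open>H\<close> that a derivation can produce consists of the standard monomials \<open>m\<close> in the value at
  \<open>a\<^sub>1b\<^sub>2\<close> that contain \<open>a\<^sub>1\<close> or \<open>b\<^sub>2\<close>; no standard monomial contains both. The summand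
  \<open>A * \<partial>/\<partial>a\<^sub>1\<close> of a derivation sends \<open>a\<^sub>1b\<^sub>2\<close> to \<open>A * b\<^sub>2\<close> for every \<open>b \<ge> a\<close>, with the same \<open>A\<close>. So the coefficient
  of \<open>H (a\<^sub>1b\<^sub>2)\<close> at \<open>b\<^sub>2e\<close> has to be independent of \<open>b\<close>, and this is the syzygy
  \<open>a\<^sub>2 * a\<^sub>1b\<^sub>2 = b\<^sub>2 * a\<^sub>1a\<^sub>2\<close>: if \<open>b\<^sub>2e\<close> is standard, then so is \<open>a\<^sub>2b\<^sub>2e\<close>, because \<open>a \<le> b\<close>. The coefficient of \<open>A\<close> at
  \<open>e\<close> can therefore be read off from \<open>H (a\<^sub>1a\<^sub>2)\<close>. The second row of variables is dual.
\<close>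

lemma subtract_derivation:
  fixes H :: "('p::{finite,order} var, 'k::field) mpoly \<Rightarrow> ('p var, 'k) mpoly"
  assumes H: "hom_lift H"
  obtains d where "d \<in> derivations"
    and "\<And>a b m. \<lbrakk>a \<le> b; standard m; Poly_Mapping.lookup m (V1 a) > 0 \<or> Poly_Mapping.lookup m (V2 b) > 0\<rbrakk>
      \<Longrightarrow> Poly_Mapping.lookup (H (gen a b) - d (gen a b)) m = 0"
proof -
  let ?A = "\<lambda>v. case v of
      V1 a \<Rightarrow> Poly_Mapping.map_key (\<lambda>e. Poly_Mapping.single (V2 a) 1 + e) (H (gen a a))
    | V2 b \<Rightarrow> Poly_Mapping.map_key (\<lambda>e. Poly_Mapping.single (V1 b) 1 + e) (H (gen b b))"
  obtain d where d: "d \<in> derivations" and val: "\<And>v. d (var_poly v) = ?A v"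
    using derivation_exists[OF finite_UNIV_var, of ?A] by blast
  have key: "Poly_Mapping.lookup (Poly_Mapping.map_key (\<lambda>e. x + e) f) m = Poly_Mapping.lookup f (x + m)"
    for x m :: "'p var \<Rightarrow>\<^sub>0 nat" and f :: "('p var, 'k) mpoly"
    by (subst map_key.rep_eq) (simp_all add: inj_on_def)
  have gen: "d (gen a b) = X1 a * d (X2 b) + X2 b * d (X1 a)" for a b :: 'p
    using d by (simp add: derivations_def mult.commute)
  show thesis
  proof (rule that[OF d])
    fix a b :: 'p and m
    assume ab: "a \<le> b" and m: "standard m"
      and pos: "Poly_Mapping.lookup m (V1 a) > 0 \<or> Poly_Mapping.lookup m (V2 b) > 0"
    from pos have "Poly_Mapping.lookup (H (gen a b)) m = Poly_Mapping.lookup (d (gen a b)) m"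
    proof
      assume V2: "Poly_Mapping.lookup m (V2 b) > 0"
      then have V1: "Poly_Mapping.lookup m (V1 a) = 0"
        using m ab unfolding standard_def by (metis less_numeral_extra(3))
      obtain e where e: "m = Poly_Mapping.single (V2 b) 1 + e"
        using V2 by (elim monomial_split) (simp add: add.commute)
      let ?n = "Poly_Mapping.single (V2 a) 1 + m"
      \<comment> \<open>As \<open>a \<le> b\<close>, whatever clashes with \<open>a\<^sub>2\<close> clashes with \<open>b\<^sub>2\<close>, which divides \<open>m\<close> already.\<close>
      have "standard ?n"
        using m V2 ab
        by (auto simp: standard_def lookup_add lookup_single when_def) (metis less_numeral_extra(3) order_trans)+
      then have "Poly_Mapping.lookup (X2 a * H (gen a b) - X2 b * H (gen a a)) ?n = 0"
        using hom_lift_relation[OF H gen_in_L2[OF ab] gen_in_L2[OF order_refl], of "X2 a" "X2 b" a]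
        by (simp add: L2_iff_standard mult_ac)
      then have "Poly_Mapping.lookup (H (gen a b)) m = Poly_Mapping.lookup (H (gen a a)) (Poly_Mapping.single (V2 a) 1 + e)"
        using lookup_monomial_times[of "Poly_Mapping.single (V2 a) 1" 1 "H (gen a b)" m]
          lookup_monomial_times[of "Poly_Mapping.single (V2 b) 1" 1 "H (gen a a)" "Poly_Mapping.single (V2 a) 1 + e"]
        by (simp add: lookup_minus e add.left_commute)
      moreover have "Poly_Mapping.lookup (d (gen a b)) m = Poly_Mapping.lookup (d (X1 a)) e"
        using lookup_var_times_eq_0[OF V1, of "d (X2 b)"]
          lookup_monomial_times[of "Poly_Mapping.single (V2 b) 1" 1 "d (X1 a)" e]
        by (simp add: gen lookup_add e)
      ultimately show ?thesis
        by (simp add: val key)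
    next
      assume V1: "Poly_Mapping.lookup m (V1 a) > 0"
      then have V2: "Poly_Mapping.lookup m (V2 b) = 0"
        using m ab unfolding standard_def by (metis less_numeral_extra(3))
      obtain e where e: "m = Poly_Mapping.single (V1 a) 1 + e"
        using V1 by (elim monomial_split) (simp add: add.commute)
      let ?n = "Poly_Mapping.single (V1 b) 1 + m"
      have "standard ?n"
        using m V1 ab
        by (auto simp: standard_def lookup_add lookup_single when_def) (metis less_numeral_extra(3) order_trans)+
      then have "Poly_Mapping.lookup (X1 b * H (gen a b) - X1 a * H (gen b b)) ?n = 0"
        using hom_lift_relation[OF H gen_in_L2[OF ab] gen_in_L2[OF order_refl], of "X1 b" "X1 a" b]
        by (simp add: L2_iff_standard mult_ac)
      then have "Poly_Mapping.lookup (H (gen a b)) m = Poly_Mapping.lookup (H (gen b b)) (Poly_Mapping.single (V1 b) 1 + e)"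
        using lookup_monomial_times[of "Poly_Mapping.single (V1 b) 1" 1 "H (gen a b)" m]
          lookup_monomial_times[of "Poly_Mapping.single (V1 a) 1" 1 "H (gen b b)" "Poly_Mapping.single (V1 b) 1 + e"]
        by (simp add: lookup_minus e add.left_commute)
      moreover have "Poly_Mapping.lookup (d (gen a b)) m = Poly_Mapping.lookup (d (X2 b)) e"
        using lookup_var_times_eq_0[OF V2, of "d (X1 a)"]
          lookup_monomial_times[of "Poly_Mapping.single (V1 a) 1" 1 "d (X2 b)" e]
        by (simp add: gen lookup_add e)
      ultimately show ?thesis
        by (simp add: val key)
    qed
    then show "Poly_Mapping.lookup (H (gen a b) - d (gen a b)) m = 0"
      by (simp add: lookup_minus)
  qed
qed

text \<open>
  What is left after the subtraction. For \<open>b' \<noteq> b\<close>, the syzygy \<open>b'\<^sub>2 * a\<^sub>1b\<^sub>2 = b\<^sub>2 * a\<^sub>1b'\<^sub>2\<close> says that the monomial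
  \<open>b'\<^sub>2m\<close>, which is not divisible by \<open>b\<^sub>2\<close>, has to vanish in \<open>S/L\<close>; the same holds in the first row.
\<close>

lemma reduced_lift_monomials:
  fixes K :: "('p::{finite,order} var, 'k::field) mpoly \<Rightarrow> ('p var, 'k) mpoly"
  assumes K: "hom_lift K"
    and reduced: "\<And>a b m. \<lbrakk>a \<le> b; standard m; Poly_Mapping.lookup m (V1 a) > 0 \<or> Poly_Mapping.lookup m (V2 b) > 0\<rbrakk>
      \<Longrightarrow> Poly_Mapping.lookup (K (gen a b)) m = 0"
    and ab: "a \<le> b" and m: "standard m" and nonzero: "Poly_Mapping.lookup (K (gen a b)) m \<noteq> 0"
  shows "a = b \<and> (\<exists>D U k. admissible a D U \<and> m = k + target_expo D U)"
proof (rule isolated_monomial_divisible[OF m ab])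
  have "\<not> (Poly_Mapping.lookup m (V1 a) > 0 \<or> Poly_Mapping.lookup m (V2 b) > 0)"
    using reduced[OF ab m] nonzero by blast
  then show V1: "Poly_Mapping.lookup m (V1 a) = 0" and V2: "Poly_Mapping.lookup m (V2 b) = 0"
    by simp_all
  show "\<not> standard (m + Poly_Mapping.single (V2 b') 1)" if b': "a \<le> b'" "b' \<noteq> b" for b'
  proof
    let ?n = "Poly_Mapping.single (V2 b') 1 + m"
    assume "standard (m + Poly_Mapping.single (V2 b') 1)"
    then have "Poly_Mapping.lookup (X2 b' * K (gen a b) - X2 b * K (gen a b')) ?n = 0"
      using hom_lift_relation[OF K gen_in_L2[OF ab] gen_in_L2[OF b'(1)], of "X2 b'" "X2 b"]
      by (simp add: L2_iff_standard mult_ac add.commute)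
    moreover have "Poly_Mapping.lookup (X2 b * K (gen a b')) ?n = 0"
      using V2 b' by (intro lookup_var_times_eq_0) (simp add: lookup_add lookup_single)
    ultimately show False
      using nonzero lookup_monomial_times[of "Poly_Mapping.single (V2 b') 1" 1 "K (gen a b)" m]
      by (simp add: lookup_minus)
  qed
  show "\<not> standard (m + Poly_Mapping.single (V1 a') 1)" if a': "a' \<le> b" "a' \<noteq> a" for a'
  proof
    let ?n = "Poly_Mapping.single (V1 a') 1 + m"
    assume "standard (m + Poly_Mapping.single (V1 a') 1)"
    then have "Poly_Mapping.lookup (X1 a' * K (gen a b) - X1 a * K (gen a' b)) ?n = 0"
      using hom_lift_relation[OF K gen_in_L2[OF ab] gen_in_L2[OF a'(1)], of "X1 a'" "X1 a"]
      by (simp add: L2_iff_standard mult_ac add.commute)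
    moreover have "Poly_Mapping.lookup (X1 a * K (gen a' b)) ?n = 0"
      using V1 a' by (intro lookup_var_times_eq_0) (simp add: lookup_add lookup_single)
    ultimately show False
      using nonzero lookup_monomial_times[of "Poly_Mapping.single (V1 a') 1" 1 "K (gen a b)" m]
      by (simp add: lookup_minus)
  qed
qed

text \<open>
  Submodules of \<open>T\<^sup>1\<close> are closed under multiples of the classes of the maps, so every value at \<open>p\<^sub>1p\<^sub>2\<close> that
  is a combination of the monomials found in \<open>reduced_lift_monomials\<close> is attained, with value zero at
  the other generators.
\<close>

lemma phi_combination_at:
  fixes N :: "(('p::{finite,order} var, 'k::field) mpoly \<Rightarrow> ('p var, 'k) mpoly set) set set"
  assumes N: "submodule N mpoly_ring (T1 L2)"
    and phis: "\<And>p D U. admissible p D U \<Longrightarrow> T1_of (phi_lift p D U) \<in> N"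
    and f: "Poly_Mapping.keys f \<subseteq> {k + target_expo D U | k D U. admissible p D U}"
  shows "\<exists>K. hom_lift K \<and> T1_of K \<in> N \<and> K (gen p p) = f \<and>
    (\<forall>a b. (a, b) \<noteq> (p, p) \<longrightarrow> K (gen a b) = 0)"
  using f
proof (induction f rule: mpoly_induct_monomials)
  case zero
  show ?case
    using submodule_closed(1)[OF N zero_derivation] by (intro exI[of _ "\<lambda>_. 0"]) (simp add: hom_lift_zero)
next
  case (monomial n c)
  then obtain k D U where n: "n = k + target_expo D U" and adm: "admissible p D U"
    by blast
  have lift: "hom_lift (phi_lift p D U :: ('p var, 'k) mpoly \<Rightarrow> _)"
    by (rule hom_lift_phi_lift[OF admissibleD(1,2)[OF adm]])
  show ?case
  proof (intro exI[of _ "\<lambda>g. Poly_Mapping.single k c * phi_lift p D U g"] conjI allI impI)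
    show "hom_lift (\<lambda>g. Poly_Mapping.single k c * phi_lift p D U g)"
      by (rule hom_lift_smult[OF lift])
    show "T1_of (\<lambda>g. Poly_Mapping.single k c * phi_lift p D U g) \<in> N"
      by (rule submodule_closed(3)[OF N lift phis[OF adm]])
    show "Poly_Mapping.single k c * phi_lift p D U (gen p p) = Poly_Mapping.single n c"
      unfolding phi_lift_gen by (simp add: mult_single n)
    show "Poly_Mapping.single k c * phi_lift p D U (gen a b) = 0" if "(a, b) \<noteq> (p, p)" for a b
      by (simp add: phi_lift_other_gen[OF that])
  qed
next
  case (add f g)
  then obtain F G where FG: "hom_lift F" "T1_of F \<in> N" "F (gen p p) = f" "\<forall>a b. (a, b) \<noteq> (p, p) \<longrightarrow> F (gen a b) = 0"
    "hom_lift G" "T1_of G \<in> N" "G (gen p p) = g" "\<forall>a b. (a, b) \<noteq> (p, p) \<longrightarrow> G (gen a b) = 0"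
    by blast
  show ?case
  proof (intro exI[of _ "\<lambda>h. F h + G h"] conjI allI impI)
    show "hom_lift (\<lambda>h. F h + G h)"
      by (rule hom_lift_add[OF FG(1,5)])
    show "T1_of (\<lambda>h. F h + G h) \<in> N"
      by (rule submodule_closed(2)[OF N FG(1,5,2,6)])
    show "F (gen p p) + G (gen p p) = f + g"
      by (simp only: FG)
    show "F (gen a b) + G (gen a b) = 0" if "(a, b) \<noteq> (p, p)" for a b
      using FG(4,8) that by (metis add_0)
  qed
qed

lemma phi_combination:
  fixes N :: "(('p::{finite,order} var, 'k::field) mpoly \<Rightarrow> ('p var, 'k) mpoly set) set set"
  assumes N: "submodule N mpoly_ring (T1 L2)"
    and phis: "\<And>p D U. admissible p D U \<Longrightarrow> T1_of (phi_lift p D U) \<in> N"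
    and F: "\<And>p. Poly_Mapping.keys (F p) \<subseteq> {k + target_expo D U | k D U. admissible p D U}"
    and "finite Q"
  shows "\<exists>K. hom_lift K \<and> T1_of K \<in> N \<and>
    (\<forall>a b. K (gen a b) = (if a = b \<and> a \<in> Q then F a else 0))"
  using \<open>finite Q\<close>
proof (induction Q)
  case empty
  show ?case
    using submodule_closed(1)[OF N zero_derivation] by (intro exI[of _ "\<lambda>_. 0"]) (simp add: hom_lift_zero)
next
  case (insert p Q)
  then obtain K where K: "hom_lift K" "T1_of K \<in> N"
    "\<forall>a b. K (gen a b) = (if a = b \<and> a \<in> Q then F a else 0)"
    by blast
  obtain G where G: "hom_lift G" "T1_of G \<in> N" "G (gen p p) = F p"
    "\<forall>a b. (a, b) \<noteq> (p, p) \<longrightarrow> G (gen a b) = 0"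
    using phi_combination_at[OF N phis F] by blast
  show ?case
  proof (intro exI[of _ "\<lambda>h. K h + G h"] conjI allI)
    show "hom_lift (\<lambda>h. K h + G h)"
      by (rule hom_lift_add[OF K(1) G(1)])
    show "T1_of (\<lambda>h. K h + G h) \<in> N"
      by (rule submodule_closed(2)[OF N K(1) G(1) K(2) G(2)])
    show "K (gen a b) + G (gen a b) = (if a = b \<and> a \<in> insert p Q then F a else 0)" for a b
    proof (cases "(a, b) = (p, p)")
      case True
      then show ?thesis
        using insert.hyps K(3) G(3) by (simp only: prod.inject) simp
    next
      case False
      then have "G (gen a b) = 0"
        using G(4) by blast
      then show ?thesis
        using False K(3) by auto
    qed
  qed
qed

text \<open>
  Modulo a derivation, \<open>H\<close> has only values at the generators \<open>p\<^sub>1p\<^sub>2\<close>, and those are combinations of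
  multiples of the monomials prescribed by the admissible triples.
\<close>

lemma phi_generate:
  fixes H :: "('p::{finite,order} var, 'k::field) mpoly \<Rightarrow> ('p var, 'k) mpoly"
  assumes N: "submodule N mpoly_ring (T1 L2)"
    and phis: "\<And>p D U. admissible p D U \<Longrightarrow> T1_of (phi_lift p D U) \<in> N"
    and H: "hom_lift H"
  shows "T1_of H \<in> N"
proof -
  obtain d where d: "d \<in> derivations"
    and reduced: "\<And>a b m. \<lbrakk>a \<le> b; standard m; Poly_Mapping.lookup m (V1 a) > 0 \<or> Poly_Mapping.lookup m (V2 b) > 0\<rbrakk>
      \<Longrightarrow> Poly_Mapping.lookup (H (gen a b) - d (gen a b)) m = 0"
    using subtract_derivation[OF H] by blast
  let ?K = "\<lambda>f. H f - d f"
  have K: "hom_lift ?K"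
    using hom_lift_add[OF H hom_lift_smult[OF derivation_hom_lift[OF d], of "- 1"]] by simp
  note monomials = reduced_lift_monomials[OF K reduced]
  let ?F = "\<lambda>p. Poly_Mapping.mapp (\<lambda>m c. if standard m then c else 0) (?K (gen p p))"
  have lookup_F: "Poly_Mapping.lookup (?F p) m = (if standard m then Poly_Mapping.lookup (?K (gen p p)) m else 0)" for p m
    by (auto simp: lookup_mapp when_def in_keys_iff)
  have "Poly_Mapping.keys (?F p) \<subseteq> {k + target_expo D U | k D U. admissible p D U}" for p
  proof
    fix m assume "m \<in> Poly_Mapping.keys (?F p)"
    then have "standard m" "Poly_Mapping.lookup (?K (gen p p)) m \<noteq> 0"
      unfolding in_keys_iff lookup_F by (simp_all split: if_splits)
    from monomials[OF _ _ _ order_refl this] show "m \<in> {k + target_expo D U | k D U. admissible p D U}"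
      by blast
  qed
  from phi_combination[OF N phis this finite, of UNIV]
  obtain G where G: "hom_lift G" "T1_of G \<in> N" "\<And>a b. G (gen a b) = (if a = b then ?F a else 0)"
    by auto
  have "?K (gen a b) - G (gen a b) \<in> L2" if ab: "a \<le> b" for a b
  proof -
    have "Poly_Mapping.lookup (?K (gen a b) - G (gen a b)) m = 0" if m: "standard m" for m
    proof (cases "a = b")
      case True
      then show ?thesis
        using m lookup_F[of b m] by (simp add: G(3) lookup_minus)
    next
      case False
      then have "Poly_Mapping.lookup (?K (gen a b)) m = 0"
        using monomials[OF _ _ _ ab m] by blast
      with False show ?thesis
        by (simp add: G(3) lookup_minus)
    qed
    then show ?thesis
      by (simp add: L2_iff_standard)
  qed
  then have "hom_of ?K = hom_of G"
    by (rule hom_of_eqI[OF K G(1)])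
  then have "T1_of ?K \<in> N"
    using G(2) by simp
  from submodule_closed(2)[OF N K derivation_hom_lift[OF d] this submodule_closed(1)[OF N d]]
  show ?thesis
    by simp
qed


section \<open>Irredundancy\<close>

text \<open>
  The homomorphisms without any divisor of \<open>t\<close> in their value at \<open>p\<^sub>1p\<^sub>2\<close>. Avoiding all divisors, and not
  only \<open>t\<close> itself, makes this closed under multiplication by \<open>S\<close>.
\<close>

definition vanishing_below :: "'p::order \<Rightarrow> ('p var \<Rightarrow>\<^sub>0 nat) \<Rightarrow> (('p var, 'k::field) mpoly \<Rightarrow> ('p var, 'k) mpoly) set"
  where "vanishing_below p t =
    {H. hom_lift H \<and> (\<forall>k m. t = k + m \<longrightarrow> Poly_Mapping.lookup (H (gen p p)) m = 0)}"

lemma submodule_vanishing_below: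
  "submodule (T1_of ` vanishing_below p t) mpoly_ring (T1 (L2 :: ('p::order var, 'k::field) mpoly set))"
proof -
  interpret T: module mpoly_ring "T1 (L2 :: ('p var, 'k) mpoly set)"
    by (rule module_T1[OF ideal_L2])
  show ?thesis
  proof (rule T.submodule_from_smult)
    show "T1_of ` vanishing_below p t \<subseteq> carrier (T1 (L2 :: ('p var, 'k) mpoly set))"
      by (auto simp: carrier_T1 vanishing_below_def)
    show "\<zero>\<^bsub>T1 L2\<^esub> \<in> T1_of ` (vanishing_below p t :: (('p var, 'k) mpoly \<Rightarrow> _) set)"
      by (rule image_eqI[of _ _ "\<lambda>_. 0"])
        (simp_all add: T1_of_derivation zero_derivation vanishing_below_def hom_lift_zero)
  next
    fix x y :: "(('p var, 'k) mpoly \<Rightarrow> ('p var, 'k) mpoly set) set"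
    assume "x \<in> T1_of ` vanishing_below p t" "y \<in> T1_of ` vanishing_below p t"
    then obtain H K where HK: "H \<in> vanishing_below p t" "K \<in> vanishing_below p t"
      and xy: "x = T1_of H" "y = T1_of K"
      by blast
    have "(\<lambda>f. H f + K f) \<in> vanishing_below p t"
      using HK by (simp add: vanishing_below_def hom_lift_add lookup_add)
    moreover have "x \<oplus>\<^bsub>T1 L2\<^esub> y = T1_of (\<lambda>f. H f + K f)"
      using HK by (simp add: xy T1_of_add vanishing_below_def)
    ultimately show "x \<oplus>\<^bsub>T1 L2\<^esub> y \<in> T1_of ` vanishing_below p t"
      by blast
  next
    fix s :: "('p var, 'k) mpoly" and x :: "(('p var, 'k) mpoly \<Rightarrow> ('p var, 'k) mpoly set) set"
    assume "x \<in> T1_of ` vanishing_below p t"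
    then obtain H where H: "H \<in> vanishing_below p t" and x: "x = T1_of H"
      by blast
    have "Poly_Mapping.lookup (s * H (gen p p)) m = 0" if "t = k + m" for k m
    proof (rule lookup_times_eq_0)
      fix a b assume "m = a + b"
      then have "t = (k + a) + b"
        using that by (simp add: add.assoc)
      then show "Poly_Mapping.lookup s a = 0 \<or> Poly_Mapping.lookup (H (gen p p)) b = 0"
        using H unfolding vanishing_below_def by blast
    qed
    then have "(\<lambda>f. s * H f) \<in> vanishing_below p t"
      using H by (auto simp: vanishing_below_def hom_lift_smult)
    moreover have "s \<odot>\<^bsub>T1 L2\<^esub> x = T1_of (\<lambda>f. s * H f)"
      using H by (simp add: x T1_of_smult[of _ H] vanishing_below_def)
    ultimately show "s \<odot>\<^bsub>T1 L2\<^esub> x \<in> T1_of ` vanishing_below p t"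
      by blast
  qed
qed

text \<open>
  A derivation \<open>d\<close> cannot help: \<open>d (p\<^sub>1p\<^sub>2)\<close> involves only monomials divisible by \<open>p\<^sub>1\<close> or \<open>p\<^sub>2\<close>, whereas
  \<open>p \<notin> D\<close> and \<open>p \<notin> U\<close>.
\<close>

lemma phi_not_vanishing_below:
  fixes p :: "'p::{finite,order}"
  assumes adm: "admissible p D U"
  shows "T1_of (phi_lift p D U) \<notin>
    T1_of ` (vanishing_below p (target_expo D U) :: (('p var, 'k::field) mpoly \<Rightarrow> _) set)"
proof
  let ?t = "target_expo D U" and ?P = "phi_lift p D U :: ('p var, 'k) mpoly \<Rightarrow> _"
  assume "T1_of ?P \<in> T1_of ` vanishing_below p ?t"
  then obtain K where K: "K \<in> vanishing_below p ?t" "T1_of ?P = T1_of K"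
    by blast
  obtain d where d: "d \<in> derivations" and eq: "\<And>f. f \<in> L2 \<Longrightarrow> ?P f - (d f + K f) \<in> L2"
    using T1_of_eqD[OF K(2) hom_lift_phi_lift[OF admissibleD(1,2)[OF adm]]] by blast
  have "standard ?t"
    using admissibleD(5)[OF adm] by (simp add: standard_target_expo)
  then have "Poly_Mapping.lookup (?P (gen p p) - (d (gen p p) + K (gen p p))) ?t = 0"
    using eq[OF gen_in_L2[OF order_refl]] unfolding L2_iff_standard by blast
  moreover have "Poly_Mapping.lookup (d (gen p p)) ?t = 0"
  proof -
    have "d (gen p p) = X1 p * d (X2 p) + X2 p * d (X1 p)"
      using d by (simp add: derivations_def mult.commute)
    moreover have "Poly_Mapping.lookup ?t (V1 p) = 0" "Poly_Mapping.lookup ?t (V2 p) = 0"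
      using admissibleD(3,4)[OF adm] by (auto simp: lookup_target_expo)
    ultimately show ?thesis
      by (simp add: lookup_add lookup_var_times_eq_0)
  qed
  moreover have "Poly_Mapping.lookup (K (gen p p)) ?t = 0"
  proof -
    have "?t = 0 + ?t"
      by simp
    then show ?thesis
      using K(1) unfolding vanishing_below_def by blast
  qed
  ultimately show False
    by (simp add: phi_lift_gen lookup_minus lookup_add)
qed

lemma inclusion_minimal_eq:
  assumes "inclusion_minimal Q A" "inclusion_minimal Q B" "B \<subseteq> A"
  shows "B = A"
  using assms unfolding inclusion_minimal_def by (metis psubsetI)

text \<open>
  Minimality of the bound sets enters here: among the monomials attached to one \<open>p\<close>, none divides
  another.
\<close>

lemma other_phi_vanishing_below:
  fixes p p' :: "'p::{finite,order}"
  assumes adm: "admissible p D U" and adm': "admissible p' D' U'" and ne: "(p', D', U') \<noteq> (p, D, U)"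
  shows "phi_lift p' D' U' \<in> (vanishing_below p (target_expo D U) :: (('p var, 'k::field) mpoly \<Rightarrow> _) set)"
proof -
  have "Poly_Mapping.lookup (phi_lift p' D' U' (gen p p) :: ('p var, 'k) mpoly) m = 0"
    if t: "target_expo D U = k + m" for k m
  proof (cases "p' = p")
    case True
    have "m \<noteq> target_expo D' U'"
    proof
      assume m: "m = target_expo D' U'"
      have le: "Poly_Mapping.lookup (target_expo D' U') v \<le> Poly_Mapping.lookup (target_expo D U) v" for v
        by (simp add: t m lookup_add)
      have "r \<in> D" if "r \<in> D'" for r
        using le[of "V1 r"] that by (auto simp: lookup_target_expo intro: ccontr)
      moreover have "s \<in> U" if "s \<in> U'" for s
        using le[of "V2 s"] that by (auto simp: lookup_target_expo intro: ccontr)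
      ultimately have sub: "D' \<subseteq> D" "U' \<subseteq> U"
        by blast+
      note min = admissible_minimal[OF adm] and min' = admissible_minimal[OF adm'[unfolded True]]
      have "D' = D" "U' = U"
        by (rule inclusion_minimal_eq[OF min(2) min'(2) sub(1)])
          (rule inclusion_minimal_eq[OF min(1) min'(1) sub(2)])
      then show False
        using ne True by simp
    qed
    then show ?thesis
      using True by (simp add: phi_lift_gen lookup_single)
  next
    case False
    then show ?thesis
      by (subst phi_lift_other_gen) simp_all
  qed
  then show ?thesis
    using hom_lift_phi_lift[OF admissibleD(1,2)[OF adm']] by (simp add: vanishing_below_def)
qed

lemma generated_submodule_least:
  "submodule N R M \<Longrightarrow> G \<subseteq> N \<Longrightarrow> generated_submodule R M G \<subseteq> N"
  by (auto simp: generated_submodule_def)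

theorem theorem6p7:
  shows
    "(\<forall>(p::'p::{finite,order}) D U. admissible p D U \<longrightarrow>
        (\<exists>!h :: ('p var, 'k::field) mpoly \<Rightarrow> ('p var, 'k) mpoly set. is_phi p D U h) \<and>
        (phi p D U :: ('p var, 'k) mpoly \<Rightarrow> ('p var, 'k) mpoly set) \<noteq> \<zero>\<^bsub>normal_module L2\<^esub>) \<and>
     inj_on (\<lambda>(p::'p, D, U). T1_class (L2 :: ('p var, 'k) mpoly set) (phi p D U))
       {(p, D, U). admissible p D U} \<and>
     minimal_generating_set mpoly_ring (T1 (L2 :: ('p var, 'k) mpoly set))
       ((\<lambda>(p::'p, D, U). T1_class L2 (phi p D U)) ` {(p, D, U). admissible p D U})"
proof (intro conjI)
  let ?A = "{(p::'p, D, U). admissible p D U}"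
  let ?c = "\<lambda>(p, D, U). T1_class (L2 :: ('p var, 'k) mpoly set) (phi p D U)"
  let ?N = "\<lambda>(p, D, U). T1_of ` (vanishing_below p (target_expo D U) :: (('p var, 'k) mpoly \<Rightarrow> _) set)"
  have c: "?c (p, D, U) = T1_of (phi_lift p D U)" if "admissible p D U" for p D U
    by (simp add: phi_eq[OF that])
  have N: "submodule (?N x) mpoly_ring (T1 L2)" for x
    by (cases x) (simp add: submodule_vanishing_below)
  have not_in: "?c x \<notin> ?N x" if in_A: "x \<in> ?A" for x
  proof -
    obtain p D U where x: "x = (p, D, U)" "admissible p D U"
      using in_A by auto
    show ?thesis
      unfolding x(1) prod.case phi_eq[OF x(2)] by (rule phi_not_vanishing_below[OF x(2)])
  qed
  have other: "?c y \<in> ?N x" if in_A: "x \<in> ?A" "y \<in> ?A" and ne: "y \<noteq> x" for x y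
  proof -
    obtain p D U where x: "x = (p, D, U)" "admissible p D U"
      using in_A(1) by auto
    obtain p' D' U' where y: "y = (p', D', U')" "admissible p' D' U'"
      using in_A(2) by auto
    show ?thesis
      unfolding x(1) y(1) prod.case phi_eq[OF y(2)]
      using other_phi_vanishing_below[OF x(2) y(2)] ne x(1) y(1) by blast
  qed
  show "\<forall>p D U. admissible p D U \<longrightarrow>
        (\<exists>!h :: ('p var, 'k) mpoly \<Rightarrow> ('p var, 'k) mpoly set. is_phi p D U h) \<and>
        (phi p D U :: ('p var, 'k) mpoly \<Rightarrow> ('p var, 'k) mpoly set) \<noteq> \<zero>\<^bsub>normal_module L2\<^esub>"
  proof (intro allI impI conjI)
    fix p :: 'p and D U
    assume adm: "admissible p D U"
    show "\<exists>!h :: ('p var, 'k) mpoly \<Rightarrow> ('p var, 'k) mpoly set. is_phi p D U h"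
      by (rule ex1I, rule is_phi_phi_lift[OF adm], erule is_phi_unique, rule is_phi_phi_lift[OF adm])
    show "(phi p D U :: ('p var, 'k) mpoly \<Rightarrow> ('p var, 'k) mpoly set) \<noteq> \<zero>\<^bsub>normal_module L2\<^esub>"
      by (rule phi_nonzero[OF adm])
  qed
  show "inj_on ?c ?A"
  proof (rule inj_onI, rule ccontr)
    fix x y assume xy: "x \<in> ?A" "y \<in> ?A" "?c x = ?c y" "x \<noteq> y"
    have "?c y \<in> ?N x"
      by (rule other[OF xy(1,2) not_sym[OF xy(4)]])
    then show False
      using not_in[OF xy(1)] unfolding xy(3) by contradiction
  qed
  show "minimal_generating_set mpoly_ring (T1 L2) (?c ` ?A)"
    unfolding minimal_generating_set_def
  proof (intro conjI allI impI)
    interpret T: module mpoly_ring "T1 (L2 :: ('p var, 'k) mpoly set)"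
      by (rule module_T1[OF ideal_L2])
    show sub: "?c ` ?A \<subseteq> carrier (T1 L2)"
      by (auto simp: phi_eq carrier_T1 intro!: imageI hom_lift_phi_lift dest: admissibleD)
    show "generated_submodule mpoly_ring (T1 L2) (?c ` ?A) = carrier (T1 L2)"
    proof
      show "generated_submodule mpoly_ring (T1 L2) (?c ` ?A) \<subseteq> carrier (T1 L2)"
        by (rule generated_submodule_least[OF T.carrier_is_submodule sub])
      show "carrier (T1 L2) \<subseteq> generated_submodule mpoly_ring (T1 L2) (?c ` ?A)"
        unfolding generated_submodule_def
      proof (intro Inter_greatest)
        fix M assume "M \<in> {N. submodule N mpoly_ring (T1 L2) \<and> ?c ` ?A \<subseteq> N}"
        then have M: "submodule M mpoly_ring (T1 L2)" and c_M: "?c ` ?A \<subseteq> M"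
          by simp_all
        have "T1_of (phi_lift p D U) \<in> M" if "admissible p D U" for p D U
        proof -
          have "?c (p, D, U) \<in> M"
            using that by (intro subsetD[OF c_M] imageI) simp
          then show ?thesis
            by (simp only: c[OF that])
        qed
        then show "carrier (T1 L2) \<subseteq> M"
          unfolding carrier_T1 by (intro image_subsetI) (simp add: phi_generate[OF M])
      qed
    qed
    fix G assume G: "G \<subset> ?c ` ?A"
    then obtain x where x: "x \<in> ?A" "?c x \<notin> G"
      by blast
    have "G \<subseteq> ?N x"
    proof
      fix g assume g: "g \<in> G"
      then obtain y where y: "y \<in> ?A" "g = ?c y"
        using G by blast
      have "y \<noteq> x"
        using g y(2) x(2) by blast
      from other[OF x(1) y(1) this] show "g \<in> ?N x"
        by (simp only: y(2))
    qed
    then have "generated_submodule mpoly_ring (T1 L2) G \<subseteq> ?N x"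
      by (rule generated_submodule_least[OF N])
    then have "?c x \<notin> generated_submodule mpoly_ring (T1 L2) G"
      by (rule contra_subsetD) (rule not_in[OF x(1)])
    moreover have "?c x \<in> carrier (T1 L2)"
      by (rule subsetD[OF sub imageI[OF x(1)]])
    ultimately show "generated_submodule mpoly_ring (T1 L2) G \<noteq> carrier (T1 L2)"
      by (intro notI) simp
  qed
qed

end
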